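(* Let $(\Omega_t)_{t\ge0}$ be a family of simply connected domains $\Omega_t\subset\mathbb{C}$. Suppose that $\Omega_s\subset\Omega_t\neq\mathbb{C}$ for all $s\ge0$ and $t\ge s$. Then the following two assertions are equivalent: (1) The family $(\Omega_t)_{t\ge0}$ is an inclusion chain. (2) There exists a Loewner chain $(f_t)$ such that $\{\Omega_t:t\ge0\}=\{f_t(\mathbb{D}):t\ge0\}$ (equality of sets of domains).
   Context: $\mathbb{D}=\{z\in\mathbb{C}:|z|<1\}$. A family $(\Omega_t)_{t\ge0}$ of simply connected domains $\Omega_t\subset\mathbb{C}$, $\Omega_t\ne\mathbb{C}$ for all $t\ge 0$, is an inclusion chain if: IC1. $\Omega_s\subset\Omega_t$ whenever $t\ge s\ge0$; IC2. whenever $t_n\to t_0$ in $[0,+\infty)$, $\Omega_{t_n}\to\Omega_{t_0}$ in the sense of (Carathéodory) kernel convergence with respect to any point of $\Omega_0$. Kernel convergence: for a sequence of domains $D_n$ all containing a fixed neighbourhood of $w_0$, the kernel with respect to $w_0$ is the largest domain $D\ni w_0$ such that every compact subset of $D$ is contained in $D_n$ for all sufficiently large $n$; $D_n\to D$ with respect to $w_0$ means that every subsequence of $(D_n)$ has the same kernel $D$ with respect to $w_0$. A family $(f_t)_{t\ge0}$ of holomorphic maps $f_t:\mathbb{D}\to\mathbb{C}$ is a Loewner chain of order $d\in[1,+\infty]$ if: LC1. each $f_t$ is univalent; LC2. $f_s(\mathbb{D})\subset f_t(\mathbb{D})$ for all $0\le s\le t$; LC3. for any compact $K\subset\mathbb{D}$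 and any $T>0$ there is a non-negative $k_{K,T}\in L^d([0,T],\mathbb{R})$ with $|f_s(z)-f_t(z)|\le\int_s^t k_{K,T}(\xi)\,d\xi$ for all $z\in K$ and all $0\le s\le t\le T$. A Loewner chain is a Loewner chain of some order $d\in[1,+\infty]$. *)

theory Defs
  imports "HOL-Complex_Analysis.Complex_Analysis"
begin

definition complex_domain :: "complex set \<Rightarrow> bool" where
  "complex_domain D \<longleftrightarrow> open D \<and> connected D \<and> D \<noteq> {}"

definition exhausted_by :: "(nat \<Rightarrow> complex set) \<Rightarrow> complex set \<Rightarrow> bool" where
  "exhausted_by D E \<longleftrightarrow>
     (\<forall>K. compact K \<and> K \<subseteq> E \<longrightarrow> (\<forall>\<^sub>F n in sequentially. K \<subseteq> D n))"

definition is_kernel :: "(nat \<Rightarrow> complex set) \<Rightarrow> complex \<Rightarrow> complex set \<Rightarrow> bool" where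
  "is_kernel D w E \<longleftrightarrow>
     complex_domain E \<and> w \<in> E \<and> exhausted_by D E \<and>
     (\<forall>E'. complex_domain E' \<and> w \<in> E' \<and> exhausted_by D E' \<longrightarrow> E' \<subseteq> E)"

text \<open>The first two conjuncts are the standing requirement under which kernels are considered:
  the \<open>D n\<close> are domains containing a common neighbourhood of \<open>w\<close>.\<close>

definition kernel_converges :: "(nat \<Rightarrow> complex set) \<Rightarrow> complex set \<Rightarrow> complex \<Rightarrow> bool" where
  "kernel_converges D E w \<longleftrightarrow>
     (\<forall>n. complex_domain (D n)) \<and>
     (\<exists>r>0. \<forall>n. ball w r \<subseteq> D n) \<and>
     (\<forall>\<sigma>. strict_mono \<sigma> \<longrightarrow> is_kernel (D \<circ> \<sigma>) w E)"

text \<open>Families indexed by \<open>[0, \<infinity>)\<close> are functions on \<^typ>\<open>real\<close>; their values at negative arguments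
  are irrelevant.\<close>

definition inclusion_chain :: "(real \<Rightarrow> complex set) \<Rightarrow> bool" where
  "inclusion_chain \<Omega> \<longleftrightarrow>
     (\<forall>t\<ge>0. complex_domain (\<Omega> t) \<and> simply_connected (\<Omega> t) \<and> \<Omega> t \<noteq> UNIV) \<and>
     (\<forall>s t. 0 \<le> s \<and> s \<le> t \<longrightarrow> \<Omega> s \<subseteq> \<Omega> t) \<and>
     (\<forall>\<tau> t0. (\<forall>n. 0 \<le> \<tau> n) \<and> 0 \<le> t0 \<and> \<tau> \<longlonglongrightarrow> t0 \<longrightarrow>
        (\<forall>w\<in>\<Omega> 0. kernel_converges (\<lambda>n. \<Omega> (\<tau> n)) (\<Omega> t0) w))"

text \<open>Membership of (the class of) \<open>k\<close> in $L^d([0,T],\mathbb{R})$; essential boundedness for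
  \<open>d = \<infinity>\<close>.\<close>

definition in_Lp :: "ennreal \<Rightarrow> real \<Rightarrow> (real \<Rightarrow> real) \<Rightarrow> bool" where
  "in_Lp d T k \<longleftrightarrow>
     k \<in> borel_measurable (lebesgue_on {0..T}) \<and>
     (if d = \<infinity> then \<exists>C. AE x in lebesgue_on {0..T}. \<bar>k x\<bar> \<le> C
      else integrable (lebesgue_on {0..T}) (\<lambda>x. \<bar>k x\<bar> powr enn2real d))"

definition loewner_chain_of_order :: "ennreal \<Rightarrow> (real \<Rightarrow> complex \<Rightarrow> complex) \<Rightarrow> bool" where
  "loewner_chain_of_order d f \<longleftrightarrow>
     1 \<le> d \<and>
     (\<forall>t\<ge>0. f t holomorphic_on ball 0 1 \<and> inj_on (f t) (ball 0 1)) \<and>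
     (\<forall>s t. 0 \<le> s \<and> s \<le> t \<longrightarrow> f s ` ball 0 1 \<subseteq> f t ` ball 0 1) \<and>
     (\<forall>K T. compact K \<and> K \<subseteq> ball 0 1 \<and> T > 0 \<longrightarrow>
        (\<exists>k. in_Lp d T k \<and> (\<forall>x\<in>{0..T}. 0 \<le> k x) \<and>
           (\<forall>z\<in>K. \<forall>s t. 0 \<le> s \<and> s \<le> t \<and> t \<le> T \<longrightarrow>
              cmod (f s z - f t z) \<le> (\<integral>x. k x \<partial>lebesgue_on {s..t}))))"

definition loewner_chain :: "(real \<Rightarrow> complex \<Rightarrow> complex) \<Rightarrow> bool" where
  "loewner_chain f \<longleftrightarrow> (\<exists>d. loewner_chain_of_order d f)"

end

theory Submission
  imports Defs "HOL-Real_Asymp.Real_Asymp"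
begin

text \<open>
  An increasing family of domains is an inclusion chain exactly when it is continuous from both
  sides: from the left, \<open>\<Omega> t\<close> is the union of the earlier domains, because the kernel of an
  increasing sequence is its union; from the right, every domain that meets \<open>\<Omega> 0\<close> and lies in all
  later domains lies in \<open>\<Omega> t\<close>, because the kernel of a decreasing sequence is a component of
  the interior of its intersection (\<open>inclusion_chain_left_continuous\<close>,
  \<open>inclusion_chain_right_continuous\<close>, \<open>continuous_chain_inclusion_chain\<close>). Both conditions depend
  only on the set of domains and not on how it is parametrized, even though the two parametrizations
  need not be related by a homeomorphism and may pause at different places
  (\<open>continuous_chain_transfer\<close>). This explains why the theorem can compare mere sets of domains.

  \<^bold>\<open>From a Loewner chain to an inclusion chain.\<close> The integral bound makes \<open>t \<mapsto> f t\<close> continuous for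
  locally uniform convergence on the disc. Left continuity of the images is Hurwitz's theorem: a
  value of \<open>f t\<close> is taken by all sufficiently close \<open>f s\<close>. For right continuity, let a domain \<open>E\<close> lie in
  \<open>f s ` ball 0 1\<close> for all \<open>s > t\<close>. The inverse functions of these \<open>f s\<close> form a bounded family on \<open>E\<close>,
  and by Montel's theorem some subsequence of them converges to a function that inverts \<open>f t\<close> on \<open>E\<close>;
  the limit stays inside the open disc because it does so at one point of \<open>E \<inter> f 0 ` ball 0 1\<close>.

  \<^bold>\<open>From an inclusion chain to a Loewner chain.\<close> Let \<open>F t\<close> be the Riemann map of \<open>\<Omega> t\<close> with
  \<open>F t 0 = w\<close> for a fixed \<open>w \<in> \<Omega> 0\<close> and with derivative \<open>a t > 0\<close> at \<open>0\<close>
  (the \<open>conformal_radius\<close> of \<open>\<Omega> t\<close> at \<open>w\<close>). For \<open>s \<le> t\<close> the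
  Schwarz lemma, applied to the self-map \<open>\<phi>\<close> of the disc with \<open>F s = F t \<circ> \<phi>\<close>, gives \<open>a s \<le> a t\<close>,
  and its sharpened form \<open>schwarz_deviation_from_identity\<close> gives
  \<open>\<bar>F s z - F t z\<bar> \<le> L * (a t - a s)\<close> on compact sets. Kernel continuity
  makes \<open>a\<close> continuous. Hence \<open>t \<mapsto> t + (a t - a 0)\<close> is an increasing bijection of \<open>{0..}\<close>, and
  in this new time both \<open>t\<close> and \<open>a\<close> are Lipschitz with constant \<open>1\<close>. So the reparametrized
  family is a Loewner chain of order \<open>\<infinity>\<close> with the same domains. Adding \<open>t\<close> is what keeps the time
  axis equal to \<open>{0..}\<close>: the function \<open>a\<close> alone may be bounded or constant on intervals.
\<close>

section \<open>Kernel convergence of increasing families\<close>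

text \<open>For an increasing family these two conditions say that the domains converge to \<open>\<Omega> t\<close> in the
  sense of kernels along sequences increasing, respectively decreasing, to \<open>t\<close>. The second one tests
  the component of the interior of an intersection against arbitrary subdomains \<open>E\<close>, so that this
  component never has to be constructed. The condition \<open>E \<inter> \<Omega> 0 \<noteq> {}\<close> stands
  for the base point of the kernel, which may be any point of \<open>\<Omega> 0\<close>.\<close>

definition left_continuous_chain :: "(real \<Rightarrow> complex set) \<Rightarrow> bool" where
  "left_continuous_chain \<Omega> \<longleftrightarrow> (\<forall>t>0. \<Omega> t \<subseteq> (\<Union>s\<in>{0..<t}. \<Omega> s))"

definition right_continuous_chain :: "(real \<Rightarrow> complex set) \<Rightarrow> bool" where
  "right_continuous_chain \<Omega> \<longleftrightarrow>
     (\<forall>t\<ge>0. \<forall>E. complex_domain E \<and> E \<inter> \<Omega> 0 \<noteq> {} \<and> (\<forall>s>t. E \<subseteq> \<Omega> s) \<longrightarrow> E \<subseteq> \<Omega> t)"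

lemma left_approach:
  fixes t :: real
  assumes "0 < t"
  shows "(\<lambda>n. t - t / (real n + 2)) \<longlonglongrightarrow> t"
    and "\<And>n. 0 \<le> t - t / (real n + 2)" and "\<And>n. t - t / (real n + 2) < t"
proof -
  show "(\<lambda>n. t - t / (real n + 2)) \<longlonglongrightarrow> t"
    by real_asymp
qed (use assms in \<open>auto simp: field_simps\<close>)

lemma right_approach:
  fixes t :: real
  shows "(\<lambda>n. t + 1 / (real n + 1)) \<longlonglongrightarrow> t" and "\<And>n. t < t + 1 / (real n + 1)"
proof -
  show "(\<lambda>n. t + 1 / (real n + 1)) \<longlonglongrightarrow> t"
    by real_asymp
qed auto

lemma inclusion_chain_left_continuous:
  assumes ic: "inclusion_chain \<Omega>"
  shows "left_continuous_chain \<Omega>"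
  unfolding left_continuous_chain_def
proof (intro allI impI subsetI)
  fix t z assume t: "(0::real) < t" and z: "z \<in> \<Omega> t"
  let ?\<tau> = "\<lambda>n. t - t / (real n + 2)"
  obtain w where w: "w \<in> \<Omega> 0"
    using ic unfolding inclusion_chain_def complex_domain_def by blast
  have "kernel_converges (\<lambda>n. \<Omega> (?\<tau> n)) (\<Omega> t) w"
    using ic left_approach[OF t] t w unfolding inclusion_chain_def by simp
  then have "is_kernel ((\<lambda>n. \<Omega> (?\<tau> n)) \<circ> id) w (\<Omega> t)"
    unfolding kernel_converges_def by (metis strict_mono_id)
  then have "\<forall>\<^sub>F n in sequentially. {z} \<subseteq> \<Omega> (?\<tau> n)"
    using z unfolding is_kernel_def exhausted_by_def by (auto dest: spec[where x="{z}"])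
  then obtain n where "z \<in> \<Omega> (?\<tau> n)"
    by (auto simp: eventually_sequentially)
  then show "z \<in> (\<Union>s\<in>{0..<t}. \<Omega> s)"
    using left_approach(2,3)[OF t, of n] by auto
qed

lemma inclusion_chain_right_continuous:
  assumes ic: "inclusion_chain \<Omega>"
  shows "right_continuous_chain \<Omega>"
  unfolding right_continuous_chain_def
proof (intro allI impI, elim conjE)
  fix t E assume t: "(0::real) \<le> t" and E: "complex_domain E" "E \<inter> \<Omega> 0 \<noteq> {}"
    and sub: "\<forall>s>t. E \<subseteq> \<Omega> s"
  let ?\<tau> = "\<lambda>n. t + 1 / (real n + 1)"
  obtain w where w: "w \<in> E" "w \<in> \<Omega> 0"
    using E by blast
  have "kernel_converges (\<lambda>n. \<Omega> (?\<tau> n)) (\<Omega> t) w"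
    using ic right_approach[of t] t w unfolding inclusion_chain_def by simp
  then have "is_kernel ((\<lambda>n. \<Omega> (?\<tau> n)) \<circ> id) w (\<Omega> t)"
    unfolding kernel_converges_def by (metis strict_mono_id)
  moreover have "exhausted_by ((\<lambda>n. \<Omega> (?\<tau> n)) \<circ> id) E"
    unfolding exhausted_by_def
  proof (intro allI impI always_eventually)
    fix K n assume "compact K \<and> K \<subseteq> E"
    then show "K \<subseteq> ((\<lambda>n. \<Omega> (?\<tau> n)) \<circ> id) n"
      using sub right_approach(2)[of t n] by (metis comp_apply id_apply subset_trans)
  qed
  ultimately show "E \<subseteq> \<Omega> t"
    using E w unfolding is_kernel_def by blast
qed

text \<open>The earlier domains form an open cover of \<open>K\<close> that is totally ordered by inclusion, so a
  finite subcover reduces to its largest member.\<close>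

lemma left_continuous_chain_compact:
  assumes dom: "\<And>t. 0 \<le> t \<Longrightarrow> complex_domain (\<Omega> t)"
    and mono: "\<And>s t. 0 \<le> s \<Longrightarrow> s \<le> t \<Longrightarrow> \<Omega> s \<subseteq> \<Omega> t"
    and left: "left_continuous_chain \<Omega>" and t: "0 < t" and K: "compact K" "K \<subseteq> \<Omega> t"
  shows "\<exists>s\<in>{0..<t}. K \<subseteq> \<Omega> s"
proof -
  have "\<forall>s\<in>{0..<t}. open (\<Omega> s)"
    using dom by (auto simp: complex_domain_def)
  then obtain S where S: "S \<subseteq> {0..<t}" "finite S" "K \<subseteq> (\<Union>s\<in>S. \<Omega> s)"
    using compactE_image[of K "{0..<t}" \<Omega>] left K t
    unfolding left_continuous_chain_def by (metis subset_trans)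
  define m where "m = Max (insert 0 S)"
  have m: "0 \<le> m" "m < t" "\<And>s. s \<in> S \<Longrightarrow> 0 \<le> s \<and> s \<le> m"
    using S t by (auto simp: m_def)
  have "K \<subseteq> \<Omega> m"
    using S m mono by blast
  then show ?thesis using m by auto
qed

text \<open>One-sided continuity suffices for arbitrary sequences: if \<open>t > 0\<close>, a compact subset of \<open>\<Omega> t\<close> already
  lies in some \<open>\<Omega> s\<close> with \<open>s < t\<close>, and \<open>s \<le> \<tau> n\<close> eventually; conversely, a domain
  exhausted by the \<open>\<Omega> (\<tau> n)\<close> lies in \<open>\<Omega> s\<close> for each \<open>s > t\<close>, since \<open>\<tau> n < s\<close>
  eventually.\<close>

lemma continuous_chain_is_kernel:
  assumes dom: "\<And>t. 0 \<le> t \<Longrightarrow> complex_domain (\<Omega> t)"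
    and mono: "\<And>s t. 0 \<le> s \<Longrightarrow> s \<le> t \<Longrightarrow> \<Omega> s \<subseteq> \<Omega> t"
    and left: "left_continuous_chain \<Omega>" and right: "right_continuous_chain \<Omega>"
    and \<tau>: "\<And>n. 0 \<le> \<tau> n" "\<tau> \<longlonglongrightarrow> t" and t: "0 \<le> t" and w: "w \<in> \<Omega> 0"
  shows "is_kernel (\<lambda>n. \<Omega> (\<tau> n)) w (\<Omega> t)"
  unfolding is_kernel_def
proof (intro conjI allI impI)
  show "complex_domain (\<Omega> t)" "w \<in> \<Omega> t"
    using dom mono t w by auto
  show "exhausted_by (\<lambda>n. \<Omega> (\<tau> n)) (\<Omega> t)"
    unfolding exhausted_by_def
  proof (intro allI impI, elim conjE)
    fix K assume K: "compact K" "K \<subseteq> \<Omega> t"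
    have "\<exists>s\<ge>0. K \<subseteq> \<Omega> s \<and> (\<forall>\<^sub>F n in sequentially. s \<le> \<tau> n)"
    proof (cases "t = 0")
      case True
      then show ?thesis using K \<tau> by auto
    next
      case False
      with t have t: "0 < t" by simp
      then obtain m where m: "0 \<le> m" "m < t" "K \<subseteq> \<Omega> m"
        using left_continuous_chain_compact[OF dom mono left t K] by auto
      have "\<forall>\<^sub>F n in sequentially. m \<le> \<tau> n"
        using order_tendstoD(1)[OF \<tau>(2) m(2)] by (auto elim: eventually_mono)
      then show ?thesis using m by blast
    qed
    then show "\<forall>\<^sub>F n in sequentially. K \<subseteq> \<Omega> (\<tau> n)"
      using mono by (fastforce elim: eventually_mono)
  qed
  fix E assume "complex_domain E \<and> w \<in> E \<and> exhausted_by (\<lambda>n. \<Omega> (\<tau> n)) E"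
  then have E: "complex_domain E" "w \<in> E" and ex: "exhausted_by (\<lambda>n. \<Omega> (\<tau> n)) E"
    by auto
  have "E \<subseteq> \<Omega> s" if s: "t < s" for s
  proof
    fix z assume "z \<in> E"
    then have "\<forall>\<^sub>F n in sequentially. {z} \<subseteq> \<Omega> (\<tau> n)"
      using ex unfolding exhausted_by_def by (auto dest: spec[where x="{z}"])
    then have "\<forall>\<^sub>F n in sequentially. {z} \<subseteq> \<Omega> (\<tau> n) \<and> \<tau> n < s"
      using order_tendstoD(2)[OF \<tau>(2) s] by eventually_elim simp
    then obtain n where "z \<in> \<Omega> (\<tau> n)" "\<tau> n < s"
      by (auto simp: eventually_sequentially)
    then show "z \<in> \<Omega> s"
      using mono[of "\<tau> n" s] \<tau>(1)[of n] by auto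
  qed
  then show "E \<subseteq> \<Omega> t"
    using right E t w unfolding right_continuous_chain_def by blast
qed

lemma continuous_chain_inclusion_chain:
  assumes dom: "\<And>t. 0 \<le> t \<Longrightarrow> complex_domain (\<Omega> t) \<and> simply_connected (\<Omega> t) \<and> \<Omega> t \<noteq> UNIV"
    and mono: "\<And>s t. 0 \<le> s \<Longrightarrow> s \<le> t \<Longrightarrow> \<Omega> s \<subseteq> \<Omega> t"
    and left: "left_continuous_chain \<Omega>" and right: "right_continuous_chain \<Omega>"
  shows "inclusion_chain \<Omega>"
proof -
  have "kernel_converges (\<lambda>n. \<Omega> (\<tau> n)) (\<Omega> t) w"
    if \<tau>: "\<And>n. 0 \<le> \<tau> n" "\<tau> \<longlonglongrightarrow> t" and t: "0 \<le> t" and w: "w \<in> \<Omega> 0" for \<tau> t w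
    unfolding kernel_converges_def
  proof (intro conjI allI impI)
    show "complex_domain (\<Omega> (\<tau> n))" for n
      using dom \<tau> by blast
    obtain r where r: "r > 0" "ball w r \<subseteq> \<Omega> 0"
      using dom[of 0] w openE unfolding complex_domain_def by (metis order_refl)
    then show "\<exists>r>0. \<forall>n. ball w r \<subseteq> \<Omega> (\<tau> n)"
      using mono[of 0] \<tau>(1) by (meson order_refl subset_trans)
    show "is_kernel ((\<lambda>n. \<Omega> (\<tau> n)) \<circ> \<sigma>) w (\<Omega> t)" if "strict_mono \<sigma>" for \<sigma>
      using continuous_chain_is_kernel[of \<Omega> "\<tau> \<circ> \<sigma>" t w] dom mono left right \<tau> t w
        LIMSEQ_subseq_LIMSEQ[OF \<tau>(2) that]
      by (simp add: o_def)
  qed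
  then show ?thesis
    unfolding inclusion_chain_def using dom mono by auto
qed

text \<open>Left continuity puts the supremum of the times \<open>s\<close> with \<open>U s \<subseteq> P\<close> among these times, which
  turns it into a last one.\<close>

lemma left_continuous_chain_threshold:
  assumes mono: "\<And>s t. 0 \<le> s \<Longrightarrow> s \<le> t \<Longrightarrow> U s \<subseteq> U t"
    and left: "left_continuous_chain U"
    and P: "U 0 \<subseteq> P" and v: "0 \<le> v" "\<not> U v \<subseteq> P"
  obtains u where "0 \<le> u" "U u \<subseteq> P" "\<And>s. u < s \<Longrightarrow> \<not> U s \<subseteq> P"
proof -
  define A where "A = {u. 0 \<le> u \<and> U u \<subseteq> P}"
  have below: "x \<le> v" if "x \<in> A" for x
  proof (rule ccontr)
    assume "\<not> x \<le> v"
    then have "U v \<subseteq> U x" using mono v by auto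
    then show False using that v by (auto simp: A_def)
  qed
  then have bdd: "bdd_above A" by (rule bdd_aboveI)
  have 0: "0 \<in> A" using P by (simp add: A_def)
  define u where "u = Sup A"
  have u0: "0 \<le> u" unfolding u_def using 0 bdd by (rule cSup_upper)
  have before: "U s \<subseteq> P" if s: "0 \<le> s" "s < u" for s
  proof -
    obtain x where "x \<in> A" "s < x"
      using less_cSupD[of A s] 0 s unfolding u_def by auto
    then show ?thesis using mono[of s x] s by (auto simp: A_def)
  qed
  then have "U u \<subseteq> P"
  proof (cases "u = 0")
    case False
    then have "U u \<subseteq> (\<Union>s\<in>{0..<u}. U s)"
      using left u0 unfolding left_continuous_chain_def by simp
    then show ?thesis using before by fastforce
  qed (use P in simp)
  moreover have "\<not> U s \<subseteq> P" if "u < s" for s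
    using cSup_upper[OF _ bdd, of s] that u0 by (auto simp: A_def u_def)
  ultimately show thesis using that u0 by blast
qed

text \<open>Suppose that \<open>\<Omega>\<close> has a jump at \<open>t\<close>. Every domain of the common range that is not contained in
  the smaller side contains the larger one. Take the threshold time \<open>u\<close> of \<open>U\<close> for the smaller side: every later member of
  \<open>U\<close> contains the larger side, so right continuity of \<open>U\<close> at \<open>u\<close> puts the larger side inside
  \<open>U u\<close>, which is contained in the smaller one. For the left limit the two sides are
  \<open>\<Union>s\<in>{0..<t}. \<Omega> s\<close> and \<open>\<Omega> t\<close>, for the right limit \<open>\<Omega> t\<close> and \<open>E\<close>. Both continuity properties of \<open>U\<close> are thus used
  for each of the two conclusions.\<close>

lemma continuous_chain_transfer:
  assumes dom: "\<And>t. 0 \<le> t \<Longrightarrow> complex_domain (\<Omega> t)"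
    and mono: "\<And>s t. 0 \<le> s \<Longrightarrow> s \<le> t \<Longrightarrow> \<Omega> s \<subseteq> \<Omega> t"
    and monoU: "\<And>s t. 0 \<le> s \<Longrightarrow> s \<le> t \<Longrightarrow> U s \<subseteq> U t"
    and left: "left_continuous_chain U" and right: "right_continuous_chain U"
    and same: "\<Omega> ` {0..} = U ` {0..}"
  shows "left_continuous_chain \<Omega>" and "right_continuous_chain \<Omega>"
proof -
  have U_eq: "\<exists>t\<ge>0. U u = \<Omega> t" if "0 \<le> u" for u
  proof -
    have "U u \<in> \<Omega> ` {0..}" unfolding same using that by simp
    then show ?thesis by auto
  qed
  have \<Omega>_eq: "\<exists>u\<ge>0. \<Omega> t = U u" if "0 \<le> t" for t
  proof -
    have "\<Omega> t \<in> U ` {0..}" unfolding same[symmetric] using that by simp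
    then show ?thesis by auto
  qed
  have \<Omega>0: "U 0 = \<Omega> 0"
  proof (rule subset_antisym)
    obtain u where "0 \<le> u" "\<Omega> 0 = U u" using \<Omega>_eq[of 0] by auto
    then show "U 0 \<subseteq> \<Omega> 0" using monoU[of 0 u] by simp
    obtain t where "0 \<le> t" "U 0 = \<Omega> t" using U_eq[of 0] by auto
    then show "\<Omega> 0 \<subseteq> U 0" using mono[of 0 t] by simp
  qed
  have least: "U 0 \<subseteq> \<Omega> t" if "0 \<le> t" for t
    using mono[of 0 t] that \<Omega>0 by simp
  show "left_continuous_chain \<Omega>"
    unfolding left_continuous_chain_def
  proof (intro allI impI)
    fix t :: real assume t: "0 < t"
    let ?P = "\<Union>s\<in>{0..<t}. \<Omega> s"
    show "\<Omega> t \<subseteq> ?P"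
    proof (rule ccontr)
      assume neg: "\<not> \<Omega> t \<subseteq> ?P"
      obtain v where v: "0 \<le> v" "\<Omega> t = U v" using \<Omega>_eq[of t] t by auto
      have "U 0 \<subseteq> ?P" using t \<Omega>0 by force
      then obtain u where u: "0 \<le> u" "U u \<subseteq> ?P" "\<And>s. u < s \<Longrightarrow> \<not> U s \<subseteq> ?P"
        using left_continuous_chain_threshold[of U ?P v] monoU left v neg by metis
      have "\<Omega> t \<subseteq> U s" if s: "u < s" for s
      proof -
        obtain x where x: "0 \<le> x" "U s = \<Omega> x" using U_eq[of s] u(1) s by auto
        have "\<not> x < t" using u(3)[OF s] x by auto
        then show ?thesis using mono[of t x] t x by simp
      qed
      moreover have "\<Omega> t \<inter> U 0 \<noteq> {}"
        using least[of t] t dom[of 0] \<Omega>0 by (auto simp: complex_domain_def)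
      ultimately have "\<Omega> t \<subseteq> U u"
        using right dom[of t] t u(1) unfolding right_continuous_chain_def by simp
      then show False using u neg by blast
    qed
  qed
  show "right_continuous_chain \<Omega>"
    unfolding right_continuous_chain_def
  proof (intro allI impI, elim conjE)
    fix t :: real and E
    assume t: "0 \<le> t" and E: "complex_domain E" "E \<inter> \<Omega> 0 \<noteq> {}"
      and sub: "\<forall>s>t. E \<subseteq> \<Omega> s"
    show "E \<subseteq> \<Omega> t"
    proof (cases "\<forall>v\<ge>0. U v \<subseteq> \<Omega> t")
      case True
      \<comment> \<open>\<open>\<Omega> t\<close> is the largest domain of the range, so \<open>\<Omega>\<close> is constant after \<open>t\<close>\<close>
      have "\<Omega> (t + 1) \<subseteq> \<Omega> t" using \<Omega>_eq[of "t + 1"] True t by auto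
      then show ?thesis using sub by (metis less_add_one subset_trans)
    next
      case False
      then obtain v where "0 \<le> v" "\<not> U v \<subseteq> \<Omega> t" by blast
      then obtain u where u: "0 \<le> u" "U u \<subseteq> \<Omega> t" "\<And>s. u < s \<Longrightarrow> \<not> U s \<subseteq> \<Omega> t"
        using left_continuous_chain_threshold[of U "\<Omega> t" v] monoU left least[OF t] by metis
      have "E \<subseteq> U s" if s: "u < s" for s
      proof -
        obtain x where x: "0 \<le> x" "U s = \<Omega> x" using U_eq[of s] u(1) s by auto
        have "t < x" using u(3)[OF s] x mono[of x t] by force
        then show ?thesis using sub x by simp
      qed
      then have "E \<subseteq> U u"
        using right E u(1) \<Omega>0 unfolding right_continuous_chain_def by simp
      then show ?thesis using u by blast
    qed
  qed
qed

section \<open>Images of a Loewner chain vary continuously\<close>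

text \<open>Otherwise \<open>F n - w\<close> has no zero in \<open>S\<close> for infinitely many \<open>n\<close>, and Hurwitz's theorem for that
  subsequence forbids the zero of \<open>g - w\<close>.\<close>

lemma Hurwitz_value_eventually_taken:
  assumes S: "open S" "connected S"
    and hol: "\<And>n. F n holomorphic_on S" and hol_g: "g holomorphic_on S"
    and lim: "\<And>K. compact K \<Longrightarrow> K \<subseteq> S \<Longrightarrow> uniform_limit K F g sequentially"
    and nonconst: "\<not> g constant_on S" and w: "w \<in> g ` S"
  shows "\<forall>\<^sub>F n in sequentially. w \<in> F n ` S"
proof (rule ccontr)
  assume "\<not> ?thesis"
  then obtain r :: "nat \<Rightarrow> nat" where r: "strict_mono r" "\<And>n. w \<notin> F (r n) ` S"
    using not_eventually_sequentiallyD by blast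
  obtain z where z: "z \<in> S" "g z = w" using w by blast
  have "g z - w \<noteq> 0"
  proof (rule Hurwitz_no_zeros[where \<F> = "\<lambda>n z. F (r n) z - w" and S = S and g = "\<lambda>z. g z - w"])
    show "(\<lambda>z. F (r n) z - w) holomorphic_on S" for n
      by (intro holomorphic_intros hol)
    show "(\<lambda>z. g z - w) holomorphic_on S"
      by (intro holomorphic_intros hol_g)
    show "uniform_limit K (\<lambda>n z. F (r n) z - w) (\<lambda>z. g z - w) sequentially"
      if "compact K" "K \<subseteq> S" for K
    proof (rule uniform_limit_minus)
      show "uniform_limit K (\<lambda>n. F (r n)) g sequentially"
        using filterlim_compose[OF lim[OF that] filterlim_subseq[OF r(1)]] by (simp add: o_def)
    qed (rule uniform_limit_const)
    show "\<not> (\<lambda>z. g z - w) constant_on S"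
      using nonconst unfolding constant_on_def by (metis diff_add_cancel)
    show "F (r n) z - w \<noteq> 0" if "z \<in> S" for n z
      using r(2)[of n] that by auto
  qed (use S z in simp_all)
  then show False using z by simp
qed

lemma inj_on_not_constant_on:
  fixes f :: "complex \<Rightarrow> complex"
  assumes "inj_on f S" "open S" "S \<noteq> {}"
  shows "\<not> f constant_on S"
proof
  assume "f constant_on S"
  then obtain c where c: "\<And>z. z \<in> S \<Longrightarrow> f z = c" unfolding constant_on_def by blast
  obtain x where x: "x \<in> S" using assms(3) by blast
  have "y = x" if "y \<in> S" for y
    using inj_onD[OF assms(1), of y x] c that x by simp
  then have "S = {x}" using x by blast
  then show False using assms(2) not_open_singleton by blast
qed

text \<open>On a bounded interval every order is at least as strong as order \<open>1\<close>, and integrability of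
  the controlling function makes its indefinite integral continuous.\<close>

lemma in_Lp_imp_integrable:
  assumes d: "1 \<le> d" and k: "in_Lp d T k"
  shows "integrable (lebesgue_on {0..T}) k"
proof -
  interpret finite_measure "lebesgue_on {0..T}"
    by (rule finite_measure_lebesgue_on) simp
  have meas: "k \<in> borel_measurable (lebesgue_on {0..T})"
    using k by (simp add: in_Lp_def)
  show ?thesis
  proof (cases "d = \<infinity>")
    case True
    then obtain C where "AE x in lebesgue_on {0..T}. \<bar>k x\<bar> \<le> C"
      using k by (auto simp: in_Lp_def)
    then show ?thesis
      using integrable_const_bound[of k C] meas by simp
  next
    case False
    let ?p = "enn2real d"
    have p: "1 \<le> ?p"
      using enn2real_mono[OF d] False by (simp add: top.not_eq_extremum)
    have int: "integrable (lebesgue_on {0..T}) (\<lambda>x. \<bar>k x\<bar> powr ?p)"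
      using k False by (simp add: in_Lp_def)
    have "\<bar>y\<bar> \<le> 1 + \<bar>y\<bar> powr ?p" for y :: real
    proof (cases "\<bar>y\<bar> \<le> 1")
      case False
      then have "\<bar>y\<bar> powr 1 \<le> \<bar>y\<bar> powr ?p"
        by (intro powr_mono p) auto
      then show ?thesis using False by simp
    qed (simp add: add_increasing2)
    then show ?thesis
      using Bochner_Integration.integrable_bound[OF Bochner_Integration.integrable_add[OF integrable_const[of 1] int] meas]
      by simp
  qed
qed

text \<open>With \<open>G\<close> an indefinite integral of the function \<open>k\<close> that controls the chain on \<open>K\<close>, the defining
  estimate becomes a modulus of continuity that is uniform in \<open>z \<in> K\<close> and symmetric in the two
  times.\<close>

lemma loewner_chain_modulus:
  assumes f: "loewner_chain f" and K: "compact K" "K \<subseteq> ball 0 1" and T: "0 < T"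
  shows "\<exists>G. continuous_on {0..T} G \<and>
    (\<forall>z\<in>K. \<forall>s\<in>{0..T}. \<forall>t\<in>{0..T}. cmod (f s z - f t z) \<le> \<bar>G s - G t\<bar>)"
proof -
  obtain d where d: "loewner_chain_of_order d f"
    using f unfolding loewner_chain_def by blast
  then have d1: "1 \<le> d" by (simp add: loewner_chain_of_order_def)
  obtain k where k: "in_Lp d T k"
    and bound: "\<And>z s t. z \<in> K \<Longrightarrow> 0 \<le> s \<Longrightarrow> s \<le> t \<Longrightarrow> t \<le> T \<Longrightarrow>
                   cmod (f s z - f t z) \<le> (\<integral>x. k x \<partial>lebesgue_on {s..t})"
    using d K T unfolding loewner_chain_of_order_def by metis
  have int: "integrable (lebesgue_on {0..T}) k"
    by (rule in_Lp_imp_integrable[OF d1 k])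
  then have int': "k integrable_on {0..T}"
    by (rule integrable_on_lebesgue_on) simp
  define G where "G t = integral {0..t} k" for t
  have le: "cmod (f s z - f t z) \<le> \<bar>G s - G t\<bar>" if "z \<in> K" "0 \<le> s" "s \<le> t" "t \<le> T" for z s t
  proof -
    have "cmod (f s z - f t z) \<le> (\<integral>x. k x \<partial>lebesgue_on {s..t})"
      using bound that by blast
    also have "\<dots> = integral {s..t} k"
      by (intro lebesgue_integral_eq_integral integrable_subinterval[OF int]) (use that in auto)
    also have "\<dots> = G t - G s"
      using Henstock_Kurzweil_Integration.integral_combine[of 0 s t k] that
        integrable_on_subinterval[OF int', of 0 t] by (simp add: G_def)
    finally show ?thesis by linarith
  qed
  have "continuous_on {0..T} G"
    unfolding G_def by (rule indefinite_integral_continuous_1[OF int'])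
  moreover have "cmod (f s z - f t z) \<le> \<bar>G s - G t\<bar>"
    if "z \<in> K" "s \<in> {0..T}" "t \<in> {0..T}" for z s t
    using le[of z s t] le[of z t s] that by (cases "s \<le> t") (auto simp: norm_minus_commute abs_minus_commute)
  ultimately show ?thesis by blast
qed

lemma loewner_chain_uniform_limit:
  assumes f: "loewner_chain f" and K: "compact K" "K \<subseteq> ball 0 1"
    and \<tau>: "\<And>n. 0 \<le> \<tau> n" "\<tau> \<longlonglongrightarrow> t" and t: "0 \<le> t"
  shows "uniform_limit K (\<lambda>n. f (\<tau> n)) (f t) sequentially"
proof -
  have T: "0 < t + 1" using t by simp
  obtain G where G: "continuous_on {0..t + 1} G"
    and le: "\<forall>z\<in>K. \<forall>r\<in>{0..t + 1}. \<forall>s\<in>{0..t + 1}. cmod (f r z - f s z) \<le> \<bar>G r - G s\<bar>"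
    using loewner_chain_modulus[OF f K T] by blast
  have ev: "\<forall>\<^sub>F n in sequentially. \<tau> n \<in> {0..t + 1}"
    using order_tendstoD(2)[OF \<tau>(2), of "t + 1"] \<tau>(1) by (auto elim: eventually_mono)
  have "(\<lambda>n. G (\<tau> n)) \<longlonglongrightarrow> G t"
    using G \<tau>(2) _ ev by (rule continuous_on_tendsto_compose) (use t in auto)
  show ?thesis
  proof (rule uniform_limitI)
    fix e :: real assume "0 < e"
    then have "\<forall>\<^sub>F n in sequentially. dist (G (\<tau> n)) (G t) < e"
      using \<open>(\<lambda>n. G (\<tau> n)) \<longlonglongrightarrow> G t\<close> by (rule tendstoD[rotated])
    with ev show "\<forall>\<^sub>F n in sequentially. \<forall>z\<in>K. dist (f (\<tau> n) z) (f t z) < e"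
    proof eventually_elim
      case (elim n)
      have "cmod (f (\<tau> n) z - f t z) \<le> \<bar>G (\<tau> n) - G t\<bar>" if "z \<in> K" for z
        using le elim(1) t that by simp
      then show ?case
        using elim(2) by (auto simp: dist_norm dist_real_def intro: le_less_trans)
    qed
  qed
qed

lemma loewner_chainD:
  assumes "loewner_chain f"
  shows "\<And>t. 0 \<le> t \<Longrightarrow> f t holomorphic_on ball 0 1"
    and "\<And>t. 0 \<le> t \<Longrightarrow> inj_on (f t) (ball 0 1)"
    and "\<And>s t. 0 \<le> s \<Longrightarrow> s \<le> t \<Longrightarrow> f s ` ball 0 1 \<subseteq> f t ` ball 0 1"
proof -
  obtain d where d: "loewner_chain_of_order d f"
    using assms unfolding loewner_chain_def by blast
  then have 1: "\<forall>t\<ge>0. f t holomorphic_on ball 0 1 \<and> inj_on (f t) (ball 0 1)"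
    and 2: "\<forall>s t. 0 \<le> s \<and> s \<le> t \<longrightarrow> f s ` ball 0 1 \<subseteq> f t ` ball 0 1"
    unfolding loewner_chain_of_order_def by simp_all
  show "f t holomorphic_on ball 0 1" "inj_on (f t) (ball 0 1)" if "0 \<le> t" for t
    using 1 that by auto
  show "f s ` ball 0 1 \<subseteq> f t ` ball 0 1" if "0 \<le> s" "s \<le> t" for s t
    using 2 that by blast
qed

lemma loewner_chain_left_continuous:
  assumes f: "loewner_chain f"
  shows "left_continuous_chain (\<lambda>t. f t ` ball 0 1)"
  unfolding left_continuous_chain_def
proof (intro allI impI subsetI)
  fix t w assume t: "(0::real) < t" and w: "w \<in> f t ` ball 0 1"
  define \<tau> where "\<tau> n = t - t / (real n + 2)" for n
  have \<tau>: "\<And>n. 0 \<le> \<tau> n" "\<And>n. \<tau> n < t" "\<tau> \<longlonglongrightarrow> t"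
    using left_approach[OF t] unfolding \<tau>_def by auto
  have ev: "\<forall>\<^sub>F n in sequentially. w \<in> f (\<tau> n) ` ball 0 1"
    by (rule Hurwitz_value_eventually_taken[where g = "f t"])
       (use loewner_chainD[OF f] \<tau> t w loewner_chain_uniform_limit[OF f, of _ \<tau> t]
         inj_on_not_constant_on[of "f t" "ball 0 1"] in auto)
  obtain n where "w \<in> f (\<tau> n) ` ball 0 1"
    using eventually_happens'[OF sequentially_bot ev] by blast
  then show "w \<in> (\<Union>s\<in>{0..<t}. f s ` ball 0 1)"
    using \<tau>(1,2)[of n] by auto
qed

text \<open>By the maximum principle \<open>g\<close> can reach the unit circle only if it is a constant of modulus \<open>1\<close>,
  which its value at \<open>w\<close> excludes.\<close>

lemma holomorphic_into_closed_disc_in_open_disc: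
  assumes E: "open E" "connected E" and g: "g holomorphic_on E"
    and le: "\<And>z. z \<in> E \<Longrightarrow> cmod (g z) \<le> 1" and w: "w \<in> E" "cmod (g w) < 1" and z: "z \<in> E"
  shows "cmod (g z) < 1"
proof (rule ccontr)
  assume "\<not> cmod (g z) < 1"
  then have 1: "cmod (g z) = 1" using le[OF z] by simp
  have "g constant_on E"
    using maximum_modulus_principle[OF g E E(1) subset_refl z] le 1 by simp
  then have "g z = g w" using w z unfolding constant_on_def by metis
  then show False using w 1 by simp
qed

lemma uniform_limit_diagonal:
  fixes F :: "nat \<Rightarrow> complex \<Rightarrow> complex"
  assumes S: "open S" and g: "continuous_on S g"
    and lim: "\<And>K. compact K \<Longrightarrow> K \<subseteq> S \<Longrightarrow> uniform_limit K F g sequentially"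
    and x: "x \<longlonglongrightarrow> a" and a: "a \<in> S"
  shows "(\<lambda>n. F n (x n)) \<longlonglongrightarrow> g a"
proof -
  obtain e where e: "0 < e" "cball a e \<subseteq> S"
    using S a open_contains_cball by blast
  have "\<forall>\<^sub>F n in sequentially. x n \<in> cball a e"
    using tendstoD[OF x e(1)] by (auto simp: dist_commute elim: eventually_mono)
  moreover have "uniform_limit (cball a e) F g sequentially"
    using lim e by auto
  ultimately have "(\<lambda>n. F n (x n) - g (x n)) \<longlonglongrightarrow> 0"
    unfolding tendsto_iff uniform_limit_iff
    by (fastforce simp: dist_norm elim: eventually_elim2)
  moreover have "(\<lambda>n. g (x n)) \<longlonglongrightarrow> g a"
    using g x S a by (simp add: continuous_on_eq_continuous_at isCont_tendsto_compose)
  ultimately show ?thesis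
    using tendsto_add by force
qed

text \<open>The inverse functions \<open>H n\<close> of \<open>f (\<tau> n)\<close> are defined on all of \<open>E\<close>. A limit \<open>g\<close> of them
  satisfies \<open>f t (g z) = z\<close> wherever \<open>g z\<close> lies in the open disc, so the point is to rule out values
  on the unit circle. Hurwitz's theorem at a point \<open>w \<in> E \<inter> f 0 ` ball 0 1\<close> keeps \<open>H n w\<close> near the
  preimage of \<open>w\<close> under \<open>f t\<close>, and the maximum principle spreads this over \<open>E\<close>.\<close>

lemma loewner_chain_right_continuous:
  assumes f: "loewner_chain f"
  shows "right_continuous_chain (\<lambda>t. f t ` ball 0 1)"
  unfolding right_continuous_chain_def
proof (intro allI impI subsetI, elim conjE)
  fix t E z
  assume t: "(0::real) \<le> t" and E: "complex_domain E" and ne: "E \<inter> f 0 ` ball 0 1 \<noteq> {}"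
    and sub: "\<forall>s>t. E \<subseteq> f s ` ball 0 1" and z: "z \<in> E"
  note hol = loewner_chainD(1)[OF f] and inj = loewner_chainD(2)[OF f]
  have openE: "open E" and connE: "connected E"
    using E by (auto simp: complex_domain_def)
  define \<tau> where "\<tau> n = t + 1 / (real n + 1)" for n
  have \<tau>: "\<And>n. t < \<tau> n" "\<tau> \<longlonglongrightarrow> t"
    using right_approach[of t] unfolding \<tau>_def by auto
  have \<tau>0: "0 \<le> \<tau> n" for n using \<tau>(1)[of n] t by simp
  have "\<exists>h. h holomorphic_on f (\<tau> n) ` ball 0 1 \<and> (\<forall>\<zeta>\<in>ball 0 1. h (f (\<tau> n) \<zeta>) = \<zeta>)" for n
    using holomorphic_has_inverse[OF hol[OF \<tau>0[of n]] open_ball inj[OF \<tau>0[of n]]] by metis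
  then obtain H where H: "\<And>n. H n holomorphic_on f (\<tau> n) ` ball 0 1"
      "\<And>n \<zeta>. \<zeta> \<in> ball 0 1 \<Longrightarrow> H n (f (\<tau> n) \<zeta>) = \<zeta>"
    by metis
  have sub\<tau>: "E \<subseteq> f (\<tau> n) ` ball 0 1" for n using sub \<tau>(1) by blast
  have H_hol: "H n holomorphic_on E" for n
    using H(1) sub\<tau> holomorphic_on_subset by blast
  have H_in: "H n y \<in> ball 0 1" "f (\<tau> n) (H n y) = y" if "y \<in> E" for n y
    using sub\<tau>[of n] that H(2)[of _ n] by force+
  obtain g r where g: "g holomorphic_on E" and r: "strict_mono (r :: nat \<Rightarrow> nat)"
    and lim: "\<And>y. y \<in> E \<Longrightarrow> (\<lambda>n. H (r n) y) \<longlonglongrightarrow> g y"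
  proof (rule Montel[of E "{h. h holomorphic_on E \<and> h ` E \<subseteq> ball 0 1}" H])
    show "\<exists>B. \<forall>h\<in>{h. h holomorphic_on E \<and> h ` E \<subseteq> ball 0 1}. \<forall>z\<in>K. cmod (h z) \<le> B"
      if "K \<subseteq> E" for K
      using that by (intro exI[of _ 1]) (fastforce intro: less_imp_le)
  qed (use openE H_hol H_in in auto)
  have g_le: "cmod (g y) \<le> 1" if "y \<in> E" for y
    by (rule Lim_norm_ubound[OF _ lim[OF that]])
       (use H_in(1)[OF that] in \<open>auto intro!: always_eventually less_imp_le\<close>)
  obtain w where w: "w \<in> E" "w \<in> f 0 ` ball 0 1" using ne by blast
  then obtain \<zeta> where \<zeta>: "\<zeta> \<in> ball 0 1" "f t \<zeta> = w"
    using loewner_chainD(3)[OF f, of 0 t] t by auto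
  obtain e where e: "0 < e" "cball \<zeta> e \<subseteq> ball 0 1"
    using \<zeta> open_contains_cball by blast
  have sub_e: "ball \<zeta> e \<subseteq> ball 0 1" using e ball_subset_cball by blast
  have "\<forall>\<^sub>F n in sequentially. w \<in> f (\<tau> n) ` ball \<zeta> e"
  proof (rule Hurwitz_value_eventually_taken[where g = "f t"])
    show "uniform_limit K (\<lambda>n. f (\<tau> n)) (f t) sequentially" if "compact K" "K \<subseteq> ball \<zeta> e" for K
      using loewner_chain_uniform_limit[OF f that(1) _ \<tau>0 \<tau>(2) t] that sub_e by blast
    show "\<not> f t constant_on ball \<zeta> e"
      using inj_on_not_constant_on[of "f t" "ball \<zeta> e"] inj[OF t] sub_e e inj_on_subset by fastforce
  qed (use hol \<tau>0 t sub_e holomorphic_on_subset \<zeta> e in \<open>auto intro: holomorphic_on_subset\<close>)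
  then have "\<forall>\<^sub>F n in sequentially. H n w \<in> cball \<zeta> e"
  proof eventually_elim
    case (elim n)
    then obtain \<xi> where "\<xi> \<in> ball \<zeta> e" "w = f (\<tau> n) \<xi>" by blast
    then show ?case using H(2)[of \<xi> n] sub_e by auto
  qed
  then have "\<forall>\<^sub>F n in sequentially. H (r n) w \<in> cball \<zeta> e"
    using r by (rule eventually_subseq[rotated])
  then have "g w \<in> cball \<zeta> e"
    using lim[OF w(1)] by (intro Lim_in_closed_set[of "cball \<zeta> e" "\<lambda>n. H (r n) w"]) auto
  then have "cmod (g w) < 1" using e by auto
  then have gz: "g z \<in> ball 0 1"
    using holomorphic_into_closed_disc_in_open_disc[OF openE connE g g_le w(1) _ z] by simp
  have "(\<lambda>n. f (\<tau> (r n)) (H (r n) z)) \<longlonglongrightarrow> f t (g z)"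
  proof (rule uniform_limit_diagonal[OF open_ball _ _ lim[OF z] gz])
    show "continuous_on (ball 0 1) (f t)"
      using hol[OF t] holomorphic_on_imp_continuous_on by blast
    show "uniform_limit K (\<lambda>n. f (\<tau> (r n))) (f t) sequentially" if "compact K" "K \<subseteq> ball 0 1" for K
      by (rule loewner_chain_uniform_limit[OF f that, of "\<lambda>n. \<tau> (r n)"])
         (use \<tau>0 t LIMSEQ_subseq_LIMSEQ[OF \<tau>(2) r] in \<open>auto simp: o_def\<close>)
  qed
  then have "(\<lambda>n::nat. z) \<longlonglongrightarrow> f t (g z)"
    using H_in(2)[OF z] by simp
  then have "z = f t (g z)"
    using LIMSEQ_unique tendsto_const by blast
  then show "z \<in> f t ` ball 0 1" using gz by blast
qed

section \<open>Riemann maps and the Schwarz lemma\<close>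

definition normalized_riemann_map :: "complex set \<Rightarrow> complex \<Rightarrow> (complex \<Rightarrow> complex) \<Rightarrow> bool" where
  "normalized_riemann_map D w f \<longleftrightarrow>
     f holomorphic_on ball 0 1 \<and> inj_on f (ball 0 1) \<and> f ` ball 0 1 = D \<and>
     f 0 = w \<and> (\<exists>a>0. deriv f 0 = of_real a)"

text \<open>Precompose a Riemann map with a disc automorphism that moves the preimage of \<open>w\<close> to \<open>0\<close>, and
  with the rotation \<open>c\<close> that makes the derivative at \<open>0\<close> positive.\<close>

lemma normalized_riemann_map_exists:
  assumes D: "open D" "simply_connected D" "D \<noteq> UNIV" and w: "w \<in> D"
  shows "\<exists>f. normalized_riemann_map D w f"
proof -
  obtain h g where hg: "h holomorphic_on D" "g holomorphic_on ball 0 1"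
    "\<forall>z\<in>D. h z \<in> ball 0 1 \<and> g (h z) = z" "\<forall>z\<in>ball 0 1. g z \<in> D \<and> h (g z) = z"
    using simply_connected_eq_biholomorphic_to_disc[OF D(1)] D w by blast
  obtain m n where m: "m (h w) = 0" "m holomorphic_on ball 0 1" "m ` ball 0 1 \<subseteq> ball 0 1"
    and n: "n holomorphic_on ball 0 1" "n ` ball 0 1 \<subseteq> ball 0 1"
    and mn: "\<And>z. z \<in> ball 0 1 \<Longrightarrow> m (n z) = z" "\<And>z. z \<in> ball 0 1 \<Longrightarrow> n (m z) = z"
    using ball_biholomorphism_exists[of "h w"] hg(3) w by metis
  define k where "k = g \<circ> n"
  have k_hol: "k holomorphic_on ball 0 1"
    unfolding k_def using holomorphic_on_compose_gen[OF n(1) hg(2)] n(2) by blast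
  have k_inj: "inj_on k (ball 0 1)"
  proof (rule inj_on_inverseI[where g = "m \<circ> h"])
    fix z :: complex assume z: "z \<in> ball 0 1"
    then have "n z \<in> ball 0 1" using n(2) by blast
    then show "(m \<circ> h) (k z) = z" using hg(4) mn(1)[OF z] by (simp add: k_def)
  qed
  have k_img: "k ` ball 0 1 = D"
  proof
    show "k ` ball 0 1 \<subseteq> D" using hg n by (auto simp: k_def)
    show "D \<subseteq> k ` ball 0 1"
    proof
      fix z assume z: "z \<in> D"
      have "m (h z) \<in> ball 0 1" using m(3) hg(3) z by blast
      moreover have "z = k (m (h z))" using mn(2) hg(3) z by (simp add: k_def)
      ultimately show "z \<in> k ` ball 0 1" by blast
    qed
  qed
  have k0: "k 0 = w"
    using m(1) mn(2)[of "h w"] hg(3) w by (auto simp: k_def)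
  have k'0: "deriv k 0 \<noteq> 0"
    using holomorphic_injective_imp_regular[OF k_hol open_ball k_inj, of 0] by simp
  \<comment> \<open>the rotation that cancels the argument of \<open>deriv k 0\<close>\<close>
  define c where "c = cnj (sgn (deriv k 0))"
  have c: "cmod c = 1" using k'0 by (simp add: c_def norm_sgn)
  have rot: "(\<lambda>z. c * z) ` ball 0 1 = ball 0 1"
  proof
    show "(\<lambda>z. c * z) ` ball 0 1 \<subseteq> ball 0 1" using c by (auto simp: norm_mult)
    show "ball 0 1 \<subseteq> (\<lambda>z. c * z) ` ball 0 1"
    proof
      fix z :: complex assume "z \<in> ball 0 1"
      moreover have "c \<noteq> 0" using c by auto
      ultimately show "z \<in> (\<lambda>z. c * z) ` ball 0 1"
        using c by (intro image_eqI[of _ _ "z / c"]) (auto simp: norm_divide)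
    qed
  qed
  define f where "f = k \<circ> (\<lambda>z. c * z)"
  have "f holomorphic_on ball 0 1"
    unfolding f_def by (rule holomorphic_on_compose_gen[OF _ k_hol]) (use rot in \<open>auto intro: holomorphic_intros\<close>)
  moreover have "inj_on f (ball 0 1)"
    unfolding f_def
    by (rule comp_inj_on) (use c k_inj rot in \<open>auto simp: inj_on_def\<close>)
  moreover have "f ` ball 0 1 = D"
    unfolding f_def image_comp[symmetric] rot k_img ..
  moreover have "f 0 = w" by (simp add: f_def k0)
  moreover have "deriv f 0 = of_real (cmod (deriv k 0))"
  proof -
    have "(k has_field_derivative deriv k 0) (at 0)"
      using k_hol by (intro holomorphic_derivI[of _ "ball 0 1"]) auto
    then have "(k has_field_derivative deriv k 0) (at (c * 0))"
      by simp
    then have "(f has_field_derivative deriv k 0 * c) (at 0)"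
      unfolding f_def by (rule DERIV_chain) (auto intro!: derivative_eq_intros)
    then have "deriv f 0 = deriv k 0 * c"
      by (rule DERIV_imp_deriv)
    also have "\<dots> = of_real (cmod (deriv k 0))"
      using k'0 by (simp add: c_def sgn_eq complex_norm_square[symmetric] power2_eq_square flip: of_real_mult of_real_divide)
    finally show ?thesis .
  qed
  ultimately show ?thesis
    unfolding normalized_riemann_map_def using k'0 by (metis zero_less_norm_iff)
qed

text \<open>A self-map of the disc that fixes \<open>0\<close> with derivative close to \<open>1\<close> is close to the identity,
  linearly in the defect \<open>1 - q\<close>. The quotient \<open>g z = \<phi> z / z\<close> maps the disc into itself unless
  \<open>\<phi>\<close> is the identity, and \<open>g 0 = q\<close>. Schwarz--Pick for \<open>g\<close> gives
  \<open>\<bar>g z - q\<bar> \<le> r * \<bar>1 - q * g z\<bar> \<le> r * ((1 - q) + \<bar>1 - g z\<bar>)\<close>. As \<open>r < 1\<close>, the last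
  summand is absorbed into \<open>\<bar>1 - g z\<bar> \<le> (1 - q) + \<bar>g z - q\<bar>\<close>, which leaves
  \<open>(1 - r) * \<bar>1 - g z\<bar> \<le> (1 + r) * (1 - q)\<close>.\<close>

lemma schwarz_deviation_from_identity:
  assumes hol: "\<phi> holomorphic_on ball 0 1" and 0: "\<phi> 0 = 0"
    and in_disc: "\<And>z. cmod z < 1 \<Longrightarrow> cmod (\<phi> z) < 1"
    and q: "deriv \<phi> 0 = of_real q" "0 \<le> q" and z: "cmod z \<le> r" and r: "r < 1"
  shows "cmod (\<phi> z - z) \<le> 2 / (1 - r) * (1 - q)"
proof -
  have schwarz: "cmod (\<phi> y) \<le> cmod y" if "cmod y < 1" for y
    by (rule Schwarz_Lemma(1)[OF hol 0 _ that]) (rule in_disc)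
  have deriv_le: "cmod (deriv \<phi> 0) \<le> 1"
    by (rule Schwarz_Lemma(2)[OF hol 0, of 0]) (use in_disc in auto)
  have z1: "cmod z < 1" using z r by simp
  have r0: "0 \<le> r" using z norm_ge_zero order_trans by blast
  have q1: "q \<le> 1" using deriv_le q by simp
  show ?thesis
  proof (cases "(\<exists>z. cmod z < 1 \<and> z \<noteq> 0 \<and> cmod (\<phi> z) = cmod z) \<or> cmod (deriv \<phi> 0) = 1")
    \<comment> \<open>equality in the Schwarz lemma: \<open>\<phi>\<close> is a rotation, and \<open>q \<ge> 0\<close> makes it the identity\<close>
    case True
    then obtain \<alpha> where \<alpha>: "\<And>z. cmod z < 1 \<Longrightarrow> \<phi> z = \<alpha> * z" "cmod \<alpha> = 1"
      using Schwarz_Lemma(3)[OF hol 0 _ z1 True] in_disc by blast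
    have "(\<phi> has_field_derivative deriv \<phi> 0) (at 0)"
      using hol by (intro holomorphic_derivI[of _ "ball 0 1"]) auto
    moreover have "(\<phi> has_field_derivative \<alpha>) (at 0)"
    proof (rule has_field_derivative_transform_within_open[where S = "ball 0 1" and f = "\<lambda>z. \<alpha> * z"])
      show "((\<lambda>z. \<alpha> * z) has_field_derivative \<alpha>) (at 0)"
        by (auto intro!: derivative_eq_intros)
    qed (use \<alpha> in auto)
    ultimately have "of_real q = \<alpha>"
      using DERIV_unique q(1) by metis
    then have "q = 1" "\<alpha> = 1" using \<alpha>(2) q(2) by auto
    then show ?thesis using \<alpha>(1)[OF z1] by simp
  next
    case False
    obtain g where g: "g holomorphic_on ball 0 1" "\<And>z. cmod z < 1 \<Longrightarrow> \<phi> z = z * g z"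
      and g0: "g 0 = of_real q"
      using Schwarz3[OF hol 0] q(1) by metis
    have g_in: "cmod (g y) < 1" if "cmod y < 1" for y
    proof (cases "y = 0")
      case True
      then show ?thesis using False g0 q q1 by auto
    next
      case y: False
      have "cmod (\<phi> y) < cmod y"
        using False that y schwarz[OF that] by force
      then show ?thesis
        using y g(2)[OF that] by (simp add: norm_mult)
    qed
    have qn: "cmod (of_real q) < 1" using g_in[of 0] g0 by simp
    define h where "h = Moebius_function 0 (of_real q) \<circ> g"
    have "h holomorphic_on ball 0 1"
      unfolding h_def
      by (rule holomorphic_on_compose_gen[OF g(1) Moebius_function_holomorphic[OF qn]]) (use g_in in auto)
    moreover have "h 0 = 0"
      by (simp add: h_def g0 Moebius_function_eq_zero)
    moreover have "cmod (h y) < 1" if "cmod y < 1" for y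
      using Moebius_function_norm_lt_1[OF qn g_in[OF that]] by (simp add: h_def)
    ultimately have "cmod (h z) \<le> cmod z"
      using z1 by (intro Schwarz_Lemma(1)) 
    then have hz: "cmod (h z) \<le> r" using z by simp
    let ?d = "1 - of_real q * g z"
    have "cmod (of_real q * g z) < 1"
      using mult_strict_mono'[OF qn g_in[OF z1]] by (simp add: norm_mult)
    then have d: "?d \<noteq> 0" by auto
    then have "g z - of_real q = h z * ?d"
      by (simp add: h_def Moebius_function_simple)
    then have "cmod (g z - of_real q) = cmod (h z) * cmod ?d"
      by (simp add: norm_mult)
    also have "\<dots> \<le> r * cmod ?d"
      using hz by (intro mult_right_mono) auto
    also have "cmod ?d \<le> (1 - q) + q * cmod (1 - g z)"
    proof -
      have "?d = of_real (1 - q) + of_real q * (1 - g z)"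
        by (simp add: algebra_simps)
      also have "cmod \<dots> \<le> cmod (of_real (1 - q)) + cmod (of_real q * (1 - g z))"
        by (rule norm_triangle_ineq)
      also have "\<dots> = (1 - q) + q * cmod (1 - g z)"
        using q q1 by (simp only: norm_mult norm_of_real)
      finally show ?thesis .
    qed
    also have "\<dots> \<le> (1 - q) + 1 * cmod (1 - g z)"
      using q1 by (intro add_left_mono mult_right_mono) auto
    finally have g_q: "cmod (g z - of_real q) \<le> r * ((1 - q) + cmod (1 - g z))"
      using r0 by (simp add: mult_left_mono)
    have "cmod (1 - g z) \<le> cmod (of_real (1 - q)) + cmod (of_real q - g z)"
      using norm_triangle_ineq[of "of_real (1 - q)" "of_real q - g z"] by simp
    also have "\<dots> = (1 - q) + cmod (g z - of_real q)"
      using q1 norm_minus_commute[of "of_real q" "g z"] by (simp only: norm_of_real)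
    also have "\<dots> \<le> (1 - q) + r * ((1 - q) + cmod (1 - g z))"
      using g_q by simp
    finally have "(1 - r) * cmod (1 - g z) \<le> (1 + r) * (1 - q)"
      by (simp add: algebra_simps)
    also have "\<dots> \<le> 2 * (1 - q)"
      using r q1 by (intro mult_right_mono) auto
    finally have *: "cmod (1 - g z) \<le> 2 / (1 - r) * (1 - q)"
      using r by (simp add: field_simps)
    have "\<phi> z - z = - (z * (1 - g z))"
      using g(2)[OF z1] by (simp add: algebra_simps)
    then have "cmod (\<phi> z - z) = cmod z * cmod (1 - g z)"
      by (simp only: norm_minus_cancel norm_mult)
    also have "\<dots> \<le> 1 * cmod (1 - g z)"
      using z1 by (intro mult_right_mono) auto
    finally show ?thesis using * by simp
  qed
qed

lemma normalized_riemann_map_subordination: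
  assumes f: "normalized_riemann_map D w f" and g: "g holomorphic_on ball 0 1"
    and gD: "g ` ball 0 1 \<subseteq> D" and g0: "g 0 = w"
  obtains \<phi> where "\<phi> holomorphic_on ball 0 1" "\<phi> 0 = 0" "\<And>z. cmod z < 1 \<Longrightarrow> cmod (\<phi> z) < 1"
    "\<And>z. cmod z < 1 \<Longrightarrow> g z = f (\<phi> z)" "deriv g 0 = deriv f 0 * deriv \<phi> 0"
proof -
  have f': "f holomorphic_on ball 0 1" "inj_on f (ball 0 1)" "f ` ball 0 1 = D" "f 0 = w"
    using f by (auto simp: normalized_riemann_map_def)
  obtain h where h: "h holomorphic_on D" "\<And>z. z \<in> ball 0 1 \<Longrightarrow> h (f z) = z"
    using holomorphic_has_inverse[OF f'(1) open_ball f'(2)] f'(3) by metis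
  define \<phi> where "\<phi> = h \<circ> g"
  have hol: "\<phi> holomorphic_on ball 0 1"
    unfolding \<phi>_def by (rule holomorphic_on_compose_gen[OF g h(1) gD])
  have 0: "\<phi> 0 = 0"
    using h(2)[of 0] f'(4) g0 by (simp add: \<phi>_def)
  have in_disc: "cmod (\<phi> z) < 1 \<and> g z = f (\<phi> z)" if z: "cmod z < 1" for z
  proof -
    have "g z \<in> f ` ball 0 1" using gD f'(3) z by auto
    then obtain x where "x \<in> ball 0 1" "g z = f x" by blast
    then show ?thesis using h(2)[of x] by (simp add: \<phi>_def)
  qed
  have "(\<phi> has_field_derivative deriv \<phi> 0) (at 0)"
    using hol by (intro holomorphic_derivI[of _ "ball 0 1"]) auto
  moreover have "(f has_field_derivative deriv f 0) (at (\<phi> 0))"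
    unfolding 0 using f'(1) by (intro holomorphic_derivI[of _ "ball 0 1"]) auto
  ultimately have "(f \<circ> \<phi> has_field_derivative deriv f 0 * deriv \<phi> 0) (at 0)"
    by (rule DERIV_chain[rotated])
  then have "(g has_field_derivative deriv f 0 * deriv \<phi> 0) (at 0)"
    by (rule has_field_derivative_transform_within_open[where S = "ball 0 1"]) (use in_disc in auto)
  then have "deriv g 0 = deriv f 0 * deriv \<phi> 0"
    by (rule DERIV_imp_deriv)
  then show thesis using that hol 0 in_disc by blast
qed

lemma bounded_holomorphic_lipschitz:
  assumes f: "f holomorphic_on ball 0 1" and r: "r < \<rho>" "\<rho> < 1"
    and M: "\<And>z. cmod z \<le> \<rho> \<Longrightarrow> cmod (f z) \<le> M" and x: "cmod x \<le> r" and y: "cmod y \<le> r"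
  shows "cmod (f x - f y) \<le> M / (\<rho> - r) * cmod (x - y)"
proof (rule field_differentiable_bound[OF convex_cball[of 0 r]])
  fix z :: complex assume z: "z \<in> cball 0 r"
  then have sub: "cball z (\<rho> - r) \<subseteq> cball 0 \<rho>"
    using norm_triangle_ineq[of z] by (auto simp: cball_subset_cball_iff)
  moreover have "cball 0 \<rho> \<subseteq> ball (0::complex) 1"
    using r(2) by (simp add: subset_iff)
  ultimately have sub1: "cball z (\<rho> - r) \<subseteq> ball 0 1"
    by (rule subset_trans)
  have "z \<in> ball 0 1" using z r by simp
  from holomorphic_derivI[OF f open_ball this]
  show "(f has_field_derivative deriv f z) (at z within cball 0 r)"
    by (rule has_field_derivative_at_within)
  have "cmod ((deriv ^^ 1) f z) \<le> fact 1 * M / (\<rho> - r) ^ 1"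
  proof (rule Cauchy_inequality)
    show "f holomorphic_on ball z (\<rho> - r)"
      by (rule holomorphic_on_subset[OF f subset_trans[OF ball_subset_cball sub1]])
    show "continuous_on (cball z (\<rho> - r)) f"
      by (rule continuous_on_subset[OF holomorphic_on_imp_continuous_on[OF f] sub1])
    show "cmod (f x) \<le> M" if "cmod (z - x) = \<rho> - r" for x
    proof (rule M)
      have "x \<in> cball z (\<rho> - r)" using that by (simp add: dist_norm)
      then show "cmod x \<le> \<rho>" using sub by auto
    qed
  qed (use r in auto)
  then show "cmod (deriv f z) \<le> M / (\<rho> - r)" by simp
qed (use x y in auto)

lemma compact_subset_unit_disc:
  fixes K :: "complex set"
  assumes K: "compact K" "K \<subseteq> ball 0 1"
  shows "\<exists>\<rho><1. K \<subseteq> cball 0 \<rho>"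
proof (cases "K = {}")
  case False
  have "continuous_on K norm" by (intro continuous_intros)
  then obtain x where "x \<in> K" "\<forall>y\<in>K. cmod y \<le> cmod x"
    using continuous_attains_sup[OF K(1) False] by blast
  then show ?thesis using K(2) by (intro exI[of _ "cmod x"]) auto
qed (auto intro: exI[of _ 0])

section \<open>Continuity of the conformal radius and change of time\<close>

text \<open>The common base point \<open>w\<close>, which lies in \<open>\<Omega> 0\<close> as the value of \<open>F 0\<close> at \<open>0\<close>, makes the
  map \<open>\<phi>\<close> with \<open>F s = F t \<circ> \<phi>\<close> fix \<open>0\<close>, so that the Schwarz lemma applies to it.\<close>

locale riemann_map_chain =
  fixes \<Omega> :: "real \<Rightarrow> complex set" and w :: complex and F :: "real \<Rightarrow> complex \<Rightarrow> complex"
  assumes domain: "\<And>t. 0 \<le> t \<Longrightarrow> complex_domain (\<Omega> t)"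
    and mono: "\<And>s t. 0 \<le> s \<Longrightarrow> s \<le> t \<Longrightarrow> \<Omega> s \<subseteq> \<Omega> t"
    and left: "left_continuous_chain \<Omega>" and right: "right_continuous_chain \<Omega>"
    and riemann_map: "\<And>t. 0 \<le> t \<Longrightarrow> normalized_riemann_map (\<Omega> t) w (F t)"
begin

definition conformal_radius :: "real \<Rightarrow> real" where
  "conformal_radius t = Re (deriv (F t) 0)"

lemma
  assumes "0 \<le> t"
  shows F_holomorphic: "F t holomorphic_on ball 0 1" and F_inj: "inj_on (F t) (ball 0 1)"
    and F_image: "F t ` ball 0 1 = \<Omega> t" and F_0: "F t 0 = w"
    and F_deriv: "deriv (F t) 0 = of_real (conformal_radius t)" and conformal_radius_pos: "0 < conformal_radius t"
  using riemann_map[OF assms] unfolding normalized_riemann_map_def conformal_radius_def by auto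

lemma F_in: "0 \<le> t \<Longrightarrow> cmod z < 1 \<Longrightarrow> F t z \<in> \<Omega> t"
  using F_image[of t] by auto

lemma subordination:
  assumes st: "0 \<le> s" "s \<le> t"
  obtains \<phi> where "\<phi> holomorphic_on ball 0 1" "\<phi> 0 = 0" "\<And>z. cmod z < 1 \<Longrightarrow> cmod (\<phi> z) < 1"
    "\<And>z. cmod z < 1 \<Longrightarrow> F s z = F t (\<phi> z)" "deriv \<phi> 0 = of_real (conformal_radius s / conformal_radius t)"
proof -
  have t: "0 \<le> t" using st by simp
  have "F s ` ball 0 1 \<subseteq> \<Omega> t" using F_image[OF st(1)] mono[OF st] by simp
  then obtain \<phi> where \<phi>: "\<phi> holomorphic_on ball 0 1" "\<phi> 0 = 0" "\<And>z. cmod z < 1 \<Longrightarrow> cmod (\<phi> z) < 1"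
    "\<And>z. cmod z < 1 \<Longrightarrow> F s z = F t (\<phi> z)" and d: "deriv (F s) 0 = deriv (F t) 0 * deriv \<phi> 0"
    using normalized_riemann_map_subordination[OF riemann_map[OF t] F_holomorphic[OF st(1)] _ F_0[OF st(1)]]
    by metis
  have "deriv \<phi> 0 = of_real (conformal_radius s / conformal_radius t)"
    using d conformal_radius_pos[OF t] unfolding F_deriv[OF st(1)] F_deriv[OF t] by (simp add: field_simps)
  then show thesis using that \<phi> by blast
qed

lemma conformal_radius_mono:
  assumes st: "0 \<le> s" "s \<le> t"
  shows "conformal_radius s \<le> conformal_radius t"
proof -
  obtain \<phi> where \<phi>: "\<phi> holomorphic_on ball 0 1" "\<phi> 0 = 0" "\<And>z. cmod z < 1 \<Longrightarrow> cmod (\<phi> z) < 1"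
    and d: "deriv \<phi> 0 = of_real (conformal_radius s / conformal_radius t)"
    by (rule subordination[OF st]) blast
  have "cmod (deriv \<phi> 0) \<le> 1"
    by (rule Schwarz_Lemma(2)[OF \<phi>(1,2), of 0]) (use \<phi>(3) in auto)
  then have "conformal_radius s / conformal_radius t \<le> 1"
    using conformal_radius_pos[of s] conformal_radius_pos[of t] st unfolding d norm_of_real by linarith
  then show ?thesis using conformal_radius_pos[of t] st by simp
qed

text \<open>By the Schwarz lemma \<open>F t\<close> maps \<open>cball 0 \<rho>\<close> into \<open>F T ` cball 0 \<rho>\<close>, so one compact set serves
  all times up to \<open>T\<close>.\<close>

lemma F_locally_bounded:
  assumes \<rho>: "\<rho> < 1" and T: "0 \<le> T"
  obtains M where "0 \<le> M" "\<And>t z. 0 \<le> t \<Longrightarrow> t \<le> T \<Longrightarrow> cmod z \<le> \<rho> \<Longrightarrow> cmod (F t z) \<le> M"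
proof -
  have "cball 0 \<rho> \<subseteq> ball (0::complex) 1" using \<rho> by (simp add: subset_iff)
  then have "compact (F T ` cball 0 \<rho>)"
    using holomorphic_on_imp_continuous_on[OF F_holomorphic[OF T]]
    by (intro compact_continuous_image) (auto intro: continuous_on_subset)
  then obtain M where M: "0 < M" "\<And>y. y \<in> F T ` cball 0 \<rho> \<Longrightarrow> cmod y \<le> M"
    using compact_imp_bounded bounded_pos by metis
  have "cmod (F t z) \<le> M" if t: "0 \<le> t" "t \<le> T" and z: "cmod z \<le> \<rho>" for t z
  proof -
    have z1: "cmod z < 1" using z \<rho> by simp
    obtain \<phi> where \<phi>: "\<phi> holomorphic_on ball 0 1" "\<phi> 0 = 0" "\<And>z. cmod z < 1 \<Longrightarrow> cmod (\<phi> z) < 1"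
      and eq: "\<And>z. cmod z < 1 \<Longrightarrow> F t z = F T (\<phi> z)"
      by (rule subordination[OF t]) blast
    have "cmod (\<phi> z) \<le> cmod z"
      by (rule Schwarz_Lemma(1)[OF \<phi>(1,2) _ z1]) (rule \<phi>(3))
    then show ?thesis using M(2)[of "F T (\<phi> z)"] eq[OF z1] z by auto
  qed
  then show thesis using that M(1) by (metis less_imp_le)
qed

text \<open>Write \<open>F s = F t \<circ> \<phi>\<close> with \<open>\<phi>\<close> of derivative \<open>q = conformal_radius s / conformal_radius t\<close> at
  \<open>0\<close>. Then \<open>\<phi>\<close> differs from the identity by a multiple of \<open>1 - q\<close>, and \<open>F t\<close> is Lipschitz on
  \<open>cball 0 r\<close> by Cauchy's estimate on the slightly larger disc of radius \<open>\<rho>\<close>.\<close>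

lemma F_lipschitz_in_radius:
  assumes r: "r < 1" and T: "0 \<le> T"
  obtains L where "0 \<le> L"
    "\<And>s t z. 0 \<le> s \<Longrightarrow> s \<le> t \<Longrightarrow> t \<le> T \<Longrightarrow> cmod z \<le> r \<Longrightarrow>
       cmod (F s z - F t z) \<le> L * (conformal_radius t - conformal_radius s)"
proof -
  define \<rho> where "\<rho> = (1 + r) / 2"
  have \<rho>: "r < \<rho>" "\<rho> < 1" using r by (auto simp: \<rho>_def)
  obtain M where M: "0 \<le> M" "\<And>t z. 0 \<le> t \<Longrightarrow> t \<le> T \<Longrightarrow> cmod z \<le> \<rho> \<Longrightarrow> cmod (F t z) \<le> M"
    by (rule F_locally_bounded[OF \<rho>(2) T]) blast
  define L where "L = M / (\<rho> - r) * (2 / (1 - r)) / conformal_radius 0"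
  have r0: "0 < conformal_radius 0" by (simp add: conformal_radius_pos)
  have C: "0 \<le> M / (\<rho> - r) * (2 / (1 - r))" using M \<rho> r by simp
  have "cmod (F s z - F t z) \<le> L * (conformal_radius t - conformal_radius s)"
    if s: "0 \<le> s" and st: "s \<le> t" and t: "t \<le> T" and z: "cmod z \<le> r" for s t z
  proof -
    have t0: "0 \<le> t" using s st by simp
    have z1: "cmod z < 1" using z r by simp
    obtain \<phi> where \<phi>: "\<phi> holomorphic_on ball 0 1" "\<phi> 0 = 0" "\<And>z. cmod z < 1 \<Longrightarrow> cmod (\<phi> z) < 1"
      and eq: "\<And>z. cmod z < 1 \<Longrightarrow> F s z = F t (\<phi> z)"
      and d: "deriv \<phi> 0 = of_real (conformal_radius s / conformal_radius t)"
      by (rule subordination[OF s st]) blast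
    have q: "0 \<le> conformal_radius s / conformal_radius t"
      using conformal_radius_pos[OF s] conformal_radius_pos[OF t0] by simp
    have "cmod (\<phi> z) \<le> cmod z"
      by (rule Schwarz_Lemma(1)[OF \<phi>(1,2) _ z1]) (rule \<phi>(3))
    then have \<phi>z: "cmod (\<phi> z) \<le> r" using z by simp
    have "cmod (F s z - F t z) = cmod (F t (\<phi> z) - F t z)"
      using eq[OF z1] by simp
    also have "\<dots> \<le> M / (\<rho> - r) * cmod (\<phi> z - z)"
      by (rule bounded_holomorphic_lipschitz[OF F_holomorphic[OF t0] \<rho> M(2)[OF t0 t] \<phi>z z])
    also have "\<dots> \<le> M / (\<rho> - r) * (2 / (1 - r) * (1 - conformal_radius s / conformal_radius t))"
      by (intro mult_left_mono schwarz_deviation_from_identity[OF \<phi>(1,2) \<phi>(3) d q z r])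
         (use M \<rho> in auto)
    also have "\<dots> = M / (\<rho> - r) * (2 / (1 - r)) * (1 - conformal_radius s / conformal_radius t)"
      by (simp only: mult.assoc)
    also have "\<dots> \<le> M / (\<rho> - r) * (2 / (1 - r)) * ((conformal_radius t - conformal_radius s) / conformal_radius 0)"
    proof (rule mult_left_mono[OF _ C])
      have "1 - conformal_radius s / conformal_radius t = (conformal_radius t - conformal_radius s) / conformal_radius t"
        using conformal_radius_pos[OF t0] by (simp add: field_simps)
      also have "\<dots> \<le> (conformal_radius t - conformal_radius s) / conformal_radius 0"
        using conformal_radius_mono[OF s st] conformal_radius_mono[OF _ t0] r0 by (intro divide_left_mono) (auto simp: conformal_radius_pos t0)
      finally show "1 - conformal_radius s / conformal_radius t \<le> (conformal_radius t - conformal_radius s) / conformal_radius 0" .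
    qed
    also have "\<dots> = L * (conformal_radius t - conformal_radius s)"
      by (simp add: L_def)
    finally show ?thesis .
  qed
  moreover have "0 \<le> L" unfolding L_def using C r0 by (intro divide_nonneg_pos)
  ultimately show thesis using that by blast
qed

text \<open>For \<open>r < 1\<close> the compact set \<open>F t ` cball 0 r\<close> already lies in some earlier \<open>\<Omega> s\<close>. Comparing
  \<open>F s\<close> with \<open>z \<mapsto> F t (r * z)\<close> gives \<open>r * conformal_radius t \<le> conformal_radius s\<close>.\<close>

lemma conformal_radius_left_approx:
  assumes t: "0 < t" and e: "0 < e"
  shows "\<exists>s\<in>{0..<t}. conformal_radius t - e < conformal_radius s"
proof -
  have t0: "0 \<le> t" using t by simp
  \<comment> \<open>so that \<open>conformal_radius t * r \<ge> conformal_radius t - e / 2\<close>; the maximum keeps \<open>r\<close> positive\<close>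
  define r where "r = max (1/2) (1 - e / (2 * conformal_radius t))"
  have r: "0 < r" "r < 1" using e conformal_radius_pos[OF t0] by (auto simp: r_def)
  have sub: "cball 0 r \<subseteq> ball (0::complex) 1" using r by (simp add: subset_iff)
  have "compact (F t ` cball 0 r)"
    using holomorphic_on_imp_continuous_on[OF F_holomorphic[OF t0]] sub
    by (intro compact_continuous_image) (auto intro: continuous_on_subset)
  moreover have "F t ` cball 0 r \<subseteq> \<Omega> t"
    using sub F_image[OF t0] by blast
  ultimately obtain s where s: "s \<in> {0..<t}" "F t ` cball 0 r \<subseteq> \<Omega> s"
    using left_continuous_chain_compact[OF domain mono left t] by blast
  then have s0: "0 \<le> s" by simp
  define g where "g = F t \<circ> (\<lambda>z. of_real r * z)"
  have scale: "of_real r * z \<in> cball 0 r" if "z \<in> ball 0 1" for z :: complex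
    using that r by (simp add: norm_mult mult_left_le)
  have "g holomorphic_on ball 0 1"
    unfolding g_def
    by (rule holomorphic_on_compose_gen[OF _ F_holomorphic[OF t0]])
       (use scale sub in \<open>auto intro!: holomorphic_intros\<close>)
  moreover have "g ` ball 0 1 \<subseteq> \<Omega> s"
    using s(2) scale unfolding g_def by fastforce
  moreover have "g 0 = w" using F_0[OF t0] by (simp add: g_def)
  ultimately obtain \<phi> where \<phi>: "\<phi> holomorphic_on ball 0 1" "\<phi> 0 = 0" "\<And>z. cmod z < 1 \<Longrightarrow> cmod (\<phi> z) < 1"
    and d: "deriv g 0 = deriv (F s) 0 * deriv \<phi> 0"
    using normalized_riemann_map_subordination[OF riemann_map[OF s0]] by metis
  have \<phi>1: "cmod (deriv \<phi> 0) \<le> 1"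
    by (rule Schwarz_Lemma(2)[OF \<phi>(1,2), of 0]) (use \<phi>(3) in auto)
  have "(F t has_field_derivative deriv (F t) 0) (at 0)"
    using holomorphic_derivI[OF F_holomorphic[OF t0] open_ball, of 0] by simp
  then have "(F t has_field_derivative deriv (F t) 0) (at (of_real r * 0))"
    by simp
  then have "(g has_field_derivative deriv (F t) 0 * of_real r) (at 0)"
    unfolding g_def by (rule DERIV_chain) (auto intro!: derivative_eq_intros)
  then have "of_real (conformal_radius s) * deriv \<phi> 0 = of_real (conformal_radius t * r)"
    using d DERIV_imp_deriv unfolding F_deriv[OF t0] F_deriv[OF s0] by fastforce
  then have "cmod (of_real (conformal_radius s) * deriv \<phi> 0) = conformal_radius t * r"
    using conformal_radius_pos[OF t0] r by (simp only: norm_of_real) simp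
  then have "conformal_radius t * r = conformal_radius s * cmod (deriv \<phi> 0)"
    using conformal_radius_pos[OF s0] by (simp add: norm_mult)
  also have "\<dots> \<le> conformal_radius s"
    using \<phi>1 conformal_radius_pos[OF s0] by (simp add: mult_left_le)
  finally have "conformal_radius t * r \<le> conformal_radius s" .
  moreover have "conformal_radius t * r \<ge> conformal_radius t * (1 - e / (2 * conformal_radius t))"
    using conformal_radius_pos[OF t0] by (intro mult_left_mono) (auto simp: r_def)
  moreover have "conformal_radius t * (1 - e / (2 * conformal_radius t)) = conformal_radius t - e / 2"
    using conformal_radius_pos[OF t0] by (simp add: field_simps)
  ultimately show ?thesis using s(1) e by (intro bexI[of _ s]) auto
qed

text \<open>If the conformal radius jumped at \<open>t\<close>, a locally uniform limit \<open>g\<close> of the maps \<open>F s\<close> with \<open>s\<close>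
  decreasing to \<open>t\<close> would have too large a derivative at \<open>0\<close>. By Hurwitz's theorem its image lies in every later
  domain, hence in \<open>\<Omega> t\<close> by right continuity, and this contradicts the Schwarz lemma. The
  image of \<open>g\<close> is a domain because a function with non-zero derivative is open.\<close>

lemma conformal_radius_right_approx:
  assumes t: "0 \<le> t" and e: "0 < e"
  shows "\<exists>s>t. conformal_radius s < conformal_radius t + e"
proof (rule ccontr)
  assume "\<not> ?thesis"
  then have gap: "\<And>s. t < s \<Longrightarrow> conformal_radius t + e \<le> conformal_radius s" by force
  define \<tau> where "\<tau> n = t + 1 / (real n + 1)" for n
  have \<tau>: "\<And>n. t < \<tau> n" "\<tau> \<longlonglongrightarrow> t"
    using right_approach[of t] unfolding \<tau>_def by auto
  have \<tau>0: "0 \<le> \<tau> n" for n using \<tau>(1)[of n] t by simp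
  have \<tau>1: "\<tau> n \<le> t + 1" for n by (simp add: \<tau>_def)
  obtain g r where g: "g holomorphic_on ball 0 1" and r: "strict_mono (r :: nat \<Rightarrow> nat)"
    and lim: "\<And>z. z \<in> ball 0 1 \<Longrightarrow> (\<lambda>n. F (\<tau> (r n)) z) \<longlonglongrightarrow> g z"
    and ulim: "\<And>K. compact K \<Longrightarrow> K \<subseteq> ball 0 1 \<Longrightarrow> uniform_limit K ((\<lambda>n. F (\<tau> n)) \<circ> r) g sequentially"
  proof (rule Montel[of "ball 0 1" "F ` {0..t + 1}" "\<lambda>n. F (\<tau> n)"])
    fix K :: "complex set" assume K: "compact K" "K \<subseteq> ball 0 1"
    obtain \<rho> where \<rho>: "\<rho> < 1" "K \<subseteq> cball 0 \<rho>"
      using compact_subset_unit_disc[OF K] by blast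
    obtain M where M: "\<And>t' z. 0 \<le> t' \<Longrightarrow> t' \<le> t + 1 \<Longrightarrow> cmod z \<le> \<rho> \<Longrightarrow> cmod (F t' z) \<le> M"
      by (rule F_locally_bounded[OF \<rho>(1), of "t + 1"]) (use t in auto)
    show "\<exists>B. \<forall>h\<in>F ` {0..t + 1}. \<forall>z\<in>K. cmod (h z) \<le> B"
      using M \<rho>(2) by (intro exI[of _ M]) auto
  qed (use F_holomorphic \<tau>0 \<tau>1 in auto)
  have "(\<lambda>n. deriv (F (\<tau> (r n))) 0) \<longlonglongrightarrow> deriv g 0"
  proof (rule deriv_complex_uniform_limit[where A = "ball 0 (1/2)"])
    have "uniform_limit (cball 0 (1/2)) ((\<lambda>n. F (\<tau> n)) \<circ> r) g sequentially"
      by (rule ulim) (auto simp: subset_iff)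
    then show "uniform_limit (ball 0 (1/2)) (\<lambda>n. F (\<tau> (r n))) g sequentially"
      unfolding o_def by (rule uniform_limit_on_subset) auto
    show "\<forall>\<^sub>F n in sequentially. F (\<tau> (r n)) holomorphic_on ball 0 (1/2)"
      by (intro always_eventually allI holomorphic_on_subset[OF F_holomorphic[OF \<tau>0]])
        (auto simp: subset_iff)
  qed auto
  then have "(\<lambda>n. Re (deriv (F (\<tau> (r n))) 0)) \<longlonglongrightarrow> Re (deriv g 0)"
    by (rule tendsto_Re)
  then have deriv_g: "conformal_radius t + e \<le> Re (deriv g 0)"
    by (rule LIMSEQ_le_const) (use gap \<tau>(1) in \<open>auto simp: conformal_radius_def\<close>)
  have nonconst: "\<not> g constant_on ball 0 1"
  proof
    assume "g constant_on ball 0 1"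
    then obtain c where "\<And>z. z \<in> ball 0 1 \<Longrightarrow> g z = c" unfolding constant_on_def by blast
    then have "(g has_field_derivative 0) (at 0)"
      using has_field_derivative_transform_within_open[OF DERIV_const open_ball, of 0 0 1 c g] by simp
    then have "deriv g 0 = 0" by (rule DERIV_imp_deriv)
    then show False using deriv_g e conformal_radius_pos[OF t] by simp
  qed
  have "open (g ` ball 0 1)"
    using open_mapping_thm[OF g open_ball connected_ball open_ball subset_refl nonconst] .
  moreover have "connected (g ` ball 0 1)"
    using holomorphic_on_imp_continuous_on[OF g] by (intro connected_continuous_image) auto
  ultimately have "complex_domain (g ` ball 0 1)"
    by (auto simp: complex_domain_def)
  moreover have g0: "g 0 = w"
    using lim[of 0] F_0[OF \<tau>0] LIMSEQ_unique tendsto_const by fastforce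
  moreover have "w \<in> \<Omega> 0" using F_in[of 0 0] F_0[of 0] by simp
  moreover have "g ` ball 0 1 \<subseteq> \<Omega> s" if s: "t < s" for s
  proof
    fix y assume y: "y \<in> g ` ball 0 1"
    have "\<forall>\<^sub>F n in sequentially. y \<in> F (\<tau> (r n)) ` ball 0 1"
      by (rule Hurwitz_value_eventually_taken[where g = g])
         (use g ulim nonconst y F_holomorphic[OF \<tau>0] in \<open>auto simp: o_def\<close>)
    moreover have "\<forall>\<^sub>F n in sequentially. \<tau> (r n) < s"
      using order_tendstoD(2)[OF LIMSEQ_subseq_LIMSEQ[OF \<tau>(2) r] s] by (simp add: o_def)
    ultimately have "\<forall>\<^sub>F n in sequentially. y \<in> \<Omega> s"
    proof eventually_elim
      case (elim n)
      then show ?case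
        using F_image[OF \<tau>0[of "r n"]] mono[OF \<tau>0[of "r n"], of s] by auto
    qed
    then show "y \<in> \<Omega> s" by simp
  qed
  moreover have "w \<in> g ` ball 0 1" using g0 by force
  ultimately have "g ` ball 0 1 \<subseteq> \<Omega> t"
    using right t unfolding right_continuous_chain_def by blast
  then obtain \<phi> where \<phi>: "\<phi> holomorphic_on ball 0 1" "\<phi> 0 = 0" "\<And>z. cmod z < 1 \<Longrightarrow> cmod (\<phi> z) < 1"
    and d: "deriv g 0 = deriv (F t) 0 * deriv \<phi> 0"
    using normalized_riemann_map_subordination[OF riemann_map[OF t] g _ g0] by metis
  have \<phi>1: "cmod (deriv \<phi> 0) \<le> 1"
    by (rule Schwarz_Lemma(2)[OF \<phi>(1,2), of 0]) (use \<phi>(3) in auto)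
  have "Re (deriv g 0) \<le> cmod (deriv g 0)" by (rule complex_Re_le_cmod)
  also have "\<dots> = conformal_radius t * cmod (deriv \<phi> 0)"
    using conformal_radius_pos[OF t] unfolding d F_deriv[OF t] by (simp add: norm_mult)
  also have "\<dots> \<le> conformal_radius t"
    using \<phi>1 conformal_radius_pos[OF t] by (simp add: mult_left_le)
  finally show False using deriv_g e by simp
qed

lemma conformal_radius_continuous: "continuous_on {0..} conformal_radius"
  unfolding continuous_on_iff
proof (intro ballI allI impI)
  fix t e :: real assume "t \<in> {0..}" and e: "0 < e"
  then have t: "0 \<le> t" by simp
  obtain b where b: "t < b" "conformal_radius b < conformal_radius t + e"
    using conformal_radius_right_approx[OF t e] by blast
  obtain a where a: "a < t" "\<And>s. 0 \<le> s \<Longrightarrow> a \<le> s \<Longrightarrow> conformal_radius t - e < conformal_radius s"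
  proof (cases "t = 0")
    case True
    then show thesis using that[of "-1"] conformal_radius_mono[of 0] e by fastforce
  next
    case False
    then obtain s where s: "s \<in> {0..<t}" "conformal_radius t - e < conformal_radius s"
      using conformal_radius_left_approx[of t e] t e by auto
    then show thesis using that[of s] conformal_radius_mono[of s] by fastforce
  qed
  show "\<exists>d>0. \<forall>s\<in>{0..}. dist s t < d \<longrightarrow> dist (conformal_radius s) (conformal_radius t) < e"
  proof (intro exI[of _ "min (t - a) (b - t)"] conjI ballI impI)
    show "0 < min (t - a) (b - t)" using a(1) b(1) by simp
    fix s assume s: "s \<in> {0..}" "dist s t < min (t - a) (b - t)"
    then have "a \<le> s" "s \<le> b" "0 \<le> s" by (auto simp: dist_real_def)
    then show "dist (conformal_radius s) (conformal_radius t) < e"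
      using a(2)[of s] conformal_radius_mono[of s b] b(2) by (auto simp: dist_real_def)
  qed
qed

text \<open>\<open>\<tau>\<close> is the inverse of \<open>A t = t + (conformal_radius t - conformal_radius 0)\<close>. The summand \<open>t\<close> makes
  \<open>A\<close> strictly increasing and unbounded even where the conformal radius is constant or bounded,
  and increments of the conformal radius never exceed those of \<open>A\<close>.\<close>

lemma conformal_radius_lipschitz_reparametrization:
  obtains \<tau> where "\<tau> ` {0..} = {0..}" "\<And>u v. 0 \<le> u \<Longrightarrow> u \<le> v \<Longrightarrow> \<tau> u \<le> \<tau> v"
    "\<And>u v. 0 \<le> u \<Longrightarrow> u \<le> v \<Longrightarrow> conformal_radius (\<tau> v) - conformal_radius (\<tau> u) \<le> v - u"
proof -
  define A where "A t = t + (conformal_radius t - conformal_radius 0)" for t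
  have A0: "A 0 = 0" by (simp add: A_def)
  have A_mono: "A s < A t" if "0 \<le> s" "s < t" for s t
    using conformal_radius_mono[of s t] that by (simp add: A_def)
  have A_ge: "t \<le> A t" if "0 \<le> t" for t
    using conformal_radius_mono[of 0 t] that by (simp add: A_def)
  have "\<exists>t\<ge>0. A t = u" if u: "0 \<le> u" for u
  proof -
    have "continuous_on {0..u} A"
      unfolding A_def using continuous_on_subset[OF conformal_radius_continuous, of "{0..u}"]
      by (intro continuous_intros) auto
    then obtain t where "0 \<le> t" "t \<le> u" "A t = u"
      using IVT'[of A 0 u u] A0 A_ge[OF u] u by auto
    then show ?thesis by blast
  qed
  then obtain \<tau> where \<tau>: "\<And>u. 0 \<le> u \<Longrightarrow> 0 \<le> \<tau> u \<and> A (\<tau> u) = u"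
    by metis
  have \<tau>_mono: "\<tau> u \<le> \<tau> v" if "0 \<le> u" "u \<le> v" for u v
    using A_mono[of "\<tau> v" "\<tau> u"] \<tau>[of u] \<tau>[of v] that by force
  have inv: "\<tau> (A t) = t" if "0 \<le> t" for t
    using A_mono[of t "\<tau> (A t)"] A_mono[of "\<tau> (A t)" t] \<tau>[of "A t"] A_ge[OF that] that by force
  have "\<tau> ` {0..} = {0..}"
  proof
    show "\<tau> ` {0..} \<subseteq> {0..}" using \<tau> by auto
    show "{0..} \<subseteq> \<tau> ` {0..}"
      using inv A_ge by (auto intro!: image_eqI[where x = "A _"] intro: order_trans)
  qed
  moreover have "conformal_radius (\<tau> v) - conformal_radius (\<tau> u) \<le> v - u" if "0 \<le> u" "u \<le> v" for u v
    using \<tau>[of u] \<tau>[of v] \<tau>_mono[OF that] that by (auto simp: A_def)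
  ultimately show thesis using that \<tau>_mono by blast
qed

lemma lipschitz_loewner_chain:
  "\<exists>f. loewner_chain f \<and> \<Omega> ` {0..} = (\<lambda>t. f t ` ball 0 1) ` {0..}"
proof -
  obtain \<tau> where \<tau>: "\<tau> ` {0..} = {0..}" "\<And>u v. 0 \<le> u \<Longrightarrow> u \<le> v \<Longrightarrow> \<tau> u \<le> \<tau> v"
    "\<And>u v. 0 \<le> u \<Longrightarrow> u \<le> v \<Longrightarrow> conformal_radius (\<tau> v) - conformal_radius (\<tau> u) \<le> v - u"
    by (rule conformal_radius_lipschitz_reparametrization) blast
  have \<tau>0: "0 \<le> \<tau> u" if "0 \<le> u" for u
    using \<tau>(1) that by (metis atLeast_iff imageI)
  define f where "f u = F (\<tau> u)" for u
  have img: "f u ` ball 0 1 = \<Omega> (\<tau> u)" if "0 \<le> u" for u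
    using F_image[OF \<tau>0[OF that]] by (simp add: f_def)
  have "loewner_chain_of_order \<infinity> f"
    unfolding loewner_chain_of_order_def
  proof (intro conjI allI impI)
    show "(1::ennreal) \<le> \<infinity>" by simp
    show "f t holomorphic_on ball 0 1" "inj_on (f t) (ball 0 1)" if "0 \<le> t" for t
      using F_holomorphic[OF \<tau>0[OF that]] F_inj[OF \<tau>0[OF that]] by (auto simp: f_def)
    show "f s ` ball 0 1 \<subseteq> f t ` ball 0 1" if "0 \<le> s \<and> s \<le> t" for s t
      using img[of s] img[of t] mono[of "\<tau> s" "\<tau> t"] \<tau>0[of s] \<tau>(2)[of s t] that by simp
    fix K T assume KT: "compact K \<and> K \<subseteq> ball (0::complex) 1 \<and> 0 < (T::real)"
    obtain r where r: "r < 1" "K \<subseteq> cball 0 r"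
      using compact_subset_unit_disc KT by blast
    have T: "0 \<le> T" using KT by simp
    obtain L where L: "0 \<le> L" "\<And>s t z. 0 \<le> s \<Longrightarrow> s \<le> t \<Longrightarrow> t \<le> \<tau> T \<Longrightarrow> cmod z \<le> r \<Longrightarrow>
       cmod (F s z - F t z) \<le> L * (conformal_radius t - conformal_radius s)"
      by (rule F_lipschitz_in_radius[OF r(1) \<tau>0[OF T]]) blast
    show "\<exists>k. in_Lp \<infinity> T k \<and> (\<forall>x\<in>{0..T}. 0 \<le> k x) \<and>
           (\<forall>z\<in>K. \<forall>s t. 0 \<le> s \<and> s \<le> t \<and> t \<le> T \<longrightarrow>
              cmod (f s z - f t z) \<le> (\<integral>x. k x \<partial>lebesgue_on {s..t}))"
    proof (intro exI[of _ "\<lambda>_. L"] conjI ballI allI impI)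
      show "in_Lp \<infinity> T (\<lambda>_. L)"
        by (auto simp: in_Lp_def)
      show "0 \<le> L" by (rule L(1))
      fix z s t assume z: "z \<in> K" and st: "0 \<le> s \<and> s \<le> t \<and> t \<le> T"
      have "cmod (f s z - f t z) \<le> L * (conformal_radius (\<tau> t) - conformal_radius (\<tau> s))"
        unfolding f_def using st z r(2) \<tau>0[of s] \<tau>(2)[of s t] \<tau>(2)[of t T] by (intro L(2)) auto
      also have "\<dots> \<le> L * (t - s)"
        using L(1) \<tau>(3)[of s t] st by (intro mult_left_mono) auto
      also have "\<dots> = (\<integral>x. L \<partial>lebesgue_on {s..t})"
        using st by (simp add: measure_restrict_space)
      finally show "cmod (f s z - f t z) \<le> (\<integral>x. L \<partial>lebesgue_on {s..t})" .
    qed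
  qed
  moreover have "\<Omega> ` {0..} = (\<lambda>t. f t ` ball 0 1) ` {0..}"
  proof -
    have "\<Omega> ` {0..} = (\<lambda>u. \<Omega> (\<tau> u)) ` {0..}"
      by (subst \<tau>(1)[symmetric]) (simp add: image_image)
    also have "\<dots> = (\<lambda>t. f t ` ball 0 1) ` {0..}"
      using img by (intro image_cong) auto
    finally show ?thesis .
  qed
  ultimately show ?thesis unfolding loewner_chain_def by blast
qed

end

section \<open>Inclusion chains are Loewner chains up to parametrization\<close>

theorem theorem1p9:
  fixes \<Omega> :: "real \<Rightarrow> complex set"
  assumes "\<And>t. t \<ge> 0 \<Longrightarrow> complex_domain (\<Omega> t) \<and> simply_connected (\<Omega> t)"
    and "\<And>s t. 0 \<le> s \<Longrightarrow> s \<le> t \<Longrightarrow> \<Omega> s \<subseteq> \<Omega> t \<and> \<Omega> t \<noteq> UNIV"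
  shows "inclusion_chain \<Omega> \<longleftrightarrow>
    (\<exists>f. loewner_chain f \<and> {\<Omega> t |t. t \<ge> 0} = {f t ` ball 0 1 |t. t \<ge> 0})"
proof -
  have dom: "complex_domain (\<Omega> t)" and sc: "simply_connected (\<Omega> t)" and ne: "\<Omega> t \<noteq> UNIV" if "0 \<le> t" for t
    using assms(1)[OF that] assms(2)[OF that order_refl] by auto
  have mono: "\<Omega> s \<subseteq> \<Omega> t" if "0 \<le> s" "s \<le> t" for s t
    using assms(2)[OF that] by blast
  have as_image: "{U t |t. t \<ge> 0} = U ` {0..}" for U :: "real \<Rightarrow> complex set"
    by auto
  show ?thesis
    unfolding as_image
  proof
    assume ic: "inclusion_chain \<Omega>"
    obtain w where w: "w \<in> \<Omega> 0"
      using dom[of 0] by (auto simp: complex_domain_def)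
    have "\<exists>f. normalized_riemann_map (\<Omega> t) w f" if t: "0 \<le> t" for t
      using dom[OF t] sc[OF t] ne[OF t] mono[of 0 t] w t
      by (intro normalized_riemann_map_exists) (auto simp: complex_domain_def)
    then obtain F where F: "\<And>t. 0 \<le> t \<Longrightarrow> normalized_riemann_map (\<Omega> t) w (F t)"
      by metis
    interpret riemann_map_chain \<Omega> w F
      by unfold_locales
        (use dom mono inclusion_chain_left_continuous[OF ic] inclusion_chain_right_continuous[OF ic] F in auto)
    show "\<exists>f. loewner_chain f \<and> \<Omega> ` {0..} = (\<lambda>t. f t ` ball 0 1) ` {0..}"
      by (rule lipschitz_loewner_chain)
  next
    assume "\<exists>f. loewner_chain f \<and> \<Omega> ` {0..} = (\<lambda>t. f t ` ball 0 1) ` {0..}"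
    then obtain f where f: "loewner_chain f" and same: "\<Omega> ` {0..} = (\<lambda>t. f t ` ball 0 1) ` {0..}"
      by blast
    note transfer = continuous_chain_transfer[OF dom mono loewner_chainD(3)[OF f]
        loewner_chain_left_continuous[OF f] loewner_chain_right_continuous[OF f] same]
    show "inclusion_chain \<Omega>"
      using dom sc ne mono transfer by (intro continuous_chain_inclusion_chain) auto
  qed
qed

end
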